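(* Let $\Gamma=(K,A,S,q,g)$ be a POMDP (with $K$, $A$, $S$ finite), let $p_1\in\Delta(K)$ be an initial belief and let $\varepsilon>0$. Then there exists a strategy $\sigma\in\Sigma$ with finite memory that is $\varepsilon$-optimal in $\Gamma(p_1)$, i.e. $\gamma^{p_1}_{\infty}(\sigma)\geq v_\infty(p_1)-\varepsilon$.
   Context: For a finite set $C$, $\Delta(C)$ denotes the set of probability distributions on $C$. A POMDP $\Gamma=(K,A,S,q,g)$ consists of a finite state space $K$, a finite action set $A$, a finite signal set $S$, a transition function $q:K\times A\to\Delta(K\times S)$ and a reward function $g:K\times A\to[0,1]$. Given an initial belief $p_1\in\Delta(K)$, the process $\Gamma(p_1)$ runs as follows: an initial state $k_1$ is drawn from $p_1$ (the decision-maker knows $p_1$ but not $k_1$); at each stage $m\ge1$ the decision-maker chooses an action $a_m\in A$, receives (without observing it) the stage reward $g_m:=g(k_m,a_m)$, then a pair $(k_{m+1},s_m)$ is drawn from $q(k_m,a_m)$; the decision-maker observes only the signal $s_m$, not $k_{m+1}$ nor the reward. Let $H_m:=(A\times S)^{m-1}$ be the set of histories before stage $m$ (with $H_1$ containing only the empty history). A strategy is a map $\sigma:\bigcup_{m\ge1}H_m\to A$; $\Sigma$ is the set of strategies. $\mathbb{P}^{p_1}_\sigma$ denotes the law on plays $(K\times A\times S)^{\mathbb{N}}$ induced by $p_1$ and $\sigma$, and $\mathbb{E}^{p_1}_\sigma$ its expectation. The long-run payoff is $\gamma^{p_1}_\infty(\sigma):=\mathbb{E}^{p_1}_\sigma\left(\liminf_{n\to\infty}\frac1n\sum_{m=1}^n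 g_m\right)$ and the value is $v_\infty(p_1):=\sup_{\sigma\in\Sigma}\gamma^{p_1}_\infty(\sigma)$. A strategy is $\varepsilon$-optimal in $\Gamma(p_1)$ if $\gamma^{p_1}_\infty(\sigma)\ge v_\infty(p_1)-\varepsilon$. A strategy has finite memory if it is realized by a finite-state transducer $(\sigma_u,\sigma_a,M,m_0)$: $M$ a finite set of memory states, $m_0\in M$ the initial memory state, $\sigma_a:M\to A$ the action selection function and $\sigma_u:M\times A\times S\to M$ the memory update function (the action at each stage is $\sigma_a$ of the current memory state, and after playing $a$ and observing $s$ the memory state $x$ is updated to $\sigma_u(x,a,s)$). *)

theory Defs
  imports "HOL-Probability.Probability"
begin

text \<open>POMDP with finite state type 'k, action type 'a, signal type 's.
  Transition q :: 'k => 'a => ('k * 's) pmf, reward g :: 'k => 'a => real.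
  Histories before stage m: lists of (action, signal) pairs of length m-1.
  A (pure) strategy maps histories to actions.\<close>

type_synonym ('a, 's) strategy = "('a \<times> 's) list \<Rightarrow> 'a"

text \<open>Random mapping representation of the transitions: at each stage an
  independent random function F : K x A -> K x S is drawn, whose values F(k,a)
  are independent with laws q k a.  The play is then a deterministic function
  of the initial state and the i.i.d. stream of such functions; the law of
  plays is the image measure.\<close>

definition trans_pmf :: "('k::finite \<Rightarrow> 'a::finite \<Rightarrow> ('k \<times> 's) pmf)
    \<Rightarrow> ('k \<times> 'a \<Rightarrow> 'k \<times> 's) pmf" where
  "trans_pmf q = Pi_pmf UNIV undefined (\<lambda>(k, a). q k a)"

text \<open>State of the process before stage n+1 (0-indexed n):
  current (hidden) state and history so far.\<close>
fun run_state :: "('a, 's) strategy \<Rightarrow> 'k \<Rightarrow> ('k \<times> 'a \<Rightarrow> 'k \<times> 's) stream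
    \<Rightarrow> nat \<Rightarrow> 'k \<times> ('a \<times> 's) list" where
  "run_state \<sigma> k1 fs 0 = (k1, [])"
| "run_state \<sigma> k1 fs (Suc n) =
     (let (k, h) = run_state \<sigma> k1 fs n; a = \<sigma> h; (k', s) = (fs !! n) (k, a)
      in (k', h @ [(a, s)]))"

definition play :: "('a, 's) strategy \<Rightarrow> 'k \<Rightarrow> ('k \<times> 'a \<Rightarrow> 'k \<times> 's) stream
    \<Rightarrow> ('k \<times> 'a \<times> 's) stream" where
  "play \<sigma> k1 fs = to_stream (\<lambda>n.
     (let (k, h) = run_state \<sigma> k1 fs n; a = \<sigma> h; (_, s) = (fs !! n) (k, a)
      in (k, a, s)))"

definition plays_law :: "('k::finite \<Rightarrow> 'a::finite \<Rightarrow> ('k \<times> 's::finite) pmf)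
    \<Rightarrow> 'k pmf \<Rightarrow> ('a, 's) strategy \<Rightarrow> ('k \<times> 'a \<times> 's) stream measure" where
  "plays_law q p1 \<sigma> =
     distr (measure_pmf p1 \<Otimes>\<^sub>M stream_space (measure_pmf (trans_pmf q)))
           (stream_space (count_space UNIV))
           (\<lambda>(k1, fs). play \<sigma> k1 fs)"

definition liminf_avg :: "('k \<Rightarrow> 'a \<Rightarrow> real) \<Rightarrow> ('k \<times> 'a \<times> 's) stream \<Rightarrow> real" where
  "liminf_avg g \<omega> = real_of_ereal (liminf (\<lambda>n.
      ereal ((\<Sum>m<Suc n. g (fst (\<omega> !! m)) (fst (snd (\<omega> !! m)))) / real (Suc n))))"

definition payoff_inf :: "('k::finite \<Rightarrow> 'a::finite \<Rightarrow> ('k \<times> 's::finite) pmf)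
    \<Rightarrow> ('k \<Rightarrow> 'a \<Rightarrow> real) \<Rightarrow> 'k pmf \<Rightarrow> ('a, 's) strategy \<Rightarrow> real" where
  "payoff_inf q g p1 \<sigma> = (\<integral>\<omega>. liminf_avg g \<omega> \<partial>plays_law q p1 \<sigma>)"

definition value_inf :: "('k::finite \<Rightarrow> 'a::finite \<Rightarrow> ('k \<times> 's::finite) pmf)
    \<Rightarrow> ('k \<Rightarrow> 'a \<Rightarrow> real) \<Rightarrow> 'k pmf \<Rightarrow> real" where
  "value_inf q g p1 = (SUP \<sigma>. payoff_inf q g p1 \<sigma>)"

text \<open>Finite memory: realized by a finite-state transducer. Memory states are
  taken from nat (any finite set of memory states can be encoded there).
  mem_state gives the memory state after reading a history.\<close>
fun mem_state :: "(nat \<Rightarrow> 'a \<Rightarrow> 's \<Rightarrow> nat) \<Rightarrow> nat \<Rightarrow> ('a \<times> 's) list \<Rightarrow> nat" where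
  "mem_state \<sigma>u x [] = x"
| "mem_state \<sigma>u x ((a, s) # h) = mem_state \<sigma>u (\<sigma>u x a s) h"

definition finite_memory :: "('a, 's) strategy \<Rightarrow> bool" where
  "finite_memory \<sigma> \<longleftrightarrow> (\<exists>(M :: nat set) m0 \<sigma>a \<sigma>u.
      finite M \<and> m0 \<in> M \<and> (\<forall>x\<in>M. \<forall>a s. \<sigma>u x a s \<in> M) \<and>
      (\<forall>h. \<sigma> h = \<sigma>a (mem_state \<sigma>u m0 h)))"

end

theory Submission
  imports Defs
begin

text \<open>
  The pairs (hidden state, residual strategy) form a Markov chain with transition operator \<open>Q\<close>;
  beliefs are not needed.  Fix a near-optimal \<open>\<sigma>\<close>.  A Banach limit of the time averages along
  the chain gives a finitely additive \<open>Q\<close>-invariant mean \<open>\<Lambda>\<close> with \<open>\<Lambda> rew\<close> at least the payoff of \<open>\<sigma>\<close>.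
  By the mean ergodic argument the expected averages \<open>avg n\<close> are Cauchy in the seminorm of \<open>\<Lambda>\<close>,
  and their one-step conditional variances vanish.  So at suitable times it is likely that, for a fast
  sequence \<open>T i\<close>, the values \<open>avg (T i)\<close> hardly change with \<open>i\<close> nor along transitions.
  If this holds for all \<open>i\<close>, then from each such state the averages have a limit which is exactly constant
  along all transitions.  Such a strategy can be replaced by one with finite memory: only the
  assignment of limits to the states reachable after a history matters, there are finitely many of
  these assignments, and after each long block one may continue from a fixed representative history
  with the same assignment; exponential moments give the almost sure bound.
  Compactness of the strategy space passes from all \<open>i\<close> to finitely many, so that after some stage
  \<open>m\<close> of \<open>\<sigma>\<close> one can switch to finite memory at small cost.
\<close>

section \<open>The law of plays\<close>

definition residual :: "('a, 's) strategy \<Rightarrow> ('a \<times> 's) list \<Rightarrow> ('a, 's) strategy" where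
  "residual \<sigma> h = (\<lambda>h'. \<sigma> (h @ h'))"

definition after :: "('a, 's) strategy \<Rightarrow> 's \<Rightarrow> ('a, 's) strategy" where
  "after \<sigma> s = residual \<sigma> [(\<sigma> [], s)]"

lemma residual_Nil [simp]: "residual \<sigma> [] = \<sigma>"
  by (simp add: residual_def)

lemma residual_residual [simp]: "residual (residual \<sigma> h) h' = residual \<sigma> (h @ h')"
  by (simp add: residual_def)

lemma residual_at_Nil: "residual \<sigma> h [] = \<sigma> h"
  by (simp add: residual_def)

lemma residual_Cons: "residual \<sigma> ((\<sigma> [], s) # h) = residual (after \<sigma> s) h"
  by (simp add: after_def)

text \<open>\<open>run_state\<close> grows the history at its end; peeling off the first noise
  function instead exposes the Markov chain on pairs (hidden state, residual strategy).\<close>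

lemma run_state_Stream:
  assumes "F (k, \<sigma> []) = (k', s)"
  shows "run_state \<sigma> k (F ## fs) (Suc n) =
    (let (k'', h) = run_state (after \<sigma> s) k' fs n in (k'', (\<sigma> [], s) # h))"
proof (induction n)
  case 0
  then show ?case using assms by simp
next
  case (Suc n)
  show ?case
    by (subst run_state.simps(2), subst Suc.IH)
      (simp add: after_def residual_def Let_def split: prod.splits)
qed

lemma play_Stream:
  assumes "F (k, \<sigma> []) = (k', s)"
  shows "play \<sigma> k (F ## fs) = (k, \<sigma> [], s) ## play (after \<sigma> s) k' fs"
proof -
  let ?X = "\<lambda>n. (let (k, h) = run_state \<sigma> k (F ## fs) n; a = \<sigma> h; (_, s) = ((F ## fs) !! n) (k, a)
      in (k, a, s))"
  let ?Y = "\<lambda>n. (let (k, h) = run_state (after \<sigma> s) k' fs n; a = after \<sigma> s h; (_, s) = (fs !! n) (k, a)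
      in (k, a, s))"
  have "?X = case_nat (k, \<sigma> [], s) ?Y"
  proof
    fix n
    show "?X n = case_nat (k, \<sigma> [], s) ?Y n"
    proof (cases n)
      case 0
      then show ?thesis using assms by simp
    next
      case (Suc m)
      have "?X (Suc m) = ?Y m"
        by (subst run_state_Stream[of F k \<sigma> k' s, OF assms]) (simp add: after_def residual_def split: prod.splits)
      then show ?thesis using Suc by simp
    qed
  qed
  then show ?thesis
    unfolding play_def by (simp only: to_stream_nat_case)
qed

lemma (in prob_space) stream_space_eq_distr_Stream:
  "stream_space M = distr (M \<Otimes>\<^sub>M stream_space M) (stream_space M) (\<lambda>(x, X). x ## X)"
proof (rule measure_eqI)
  interpret S: prob_space "stream_space M" by (rule prob_space_stream_space)
  fix A assume A [measurable]: "A \<in> sets (stream_space M)"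
  have "emeasure (stream_space M) A = (\<integral>\<^sup>+ X. indicator A X \<partial>stream_space M)" by simp
  also have "\<dots> = (\<integral>\<^sup>+x. (\<integral>\<^sup>+X. indicator A (x ## X) \<partial>stream_space M) \<partial>M)"
    by (rule nn_integral_stream_space) simp
  also have "\<dots> = (\<integral>\<^sup>+z. indicator A (case z of (x, X) \<Rightarrow> x ## X) \<partial>(M \<Otimes>\<^sub>M stream_space M))"
    by (subst S.nn_integral_fst[symmetric]) simp_all
  also have "\<dots> = (\<integral>\<^sup>+z. indicator A z \<partial>(distr (M \<Otimes>\<^sub>M stream_space M) (stream_space M) (\<lambda>(x, X). x ## X)))"
    by (subst nn_integral_distr) simp_all
  finally show "emeasure (stream_space M) A =
      emeasure (distr (M \<Otimes>\<^sub>M stream_space M) (stream_space M) (\<lambda>(x, X). x ## X)) A"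
    by simp
qed simp

lemma (in prob_space) integral_stream_space:
  fixes f :: "'a stream \<Rightarrow> real"
  assumes [measurable]: "f \<in> borel_measurable (stream_space M)" and bd: "\<And>X. \<bar>f X\<bar> \<le> C"
  shows "(\<integral>X. f X \<partial>stream_space M) = (\<integral>x. (\<integral>X. f (x ## X) \<partial>stream_space M) \<partial>M)"
proof -
  interpret S: prob_space "stream_space M" by (rule prob_space_stream_space)
  interpret P: pair_prob_space M "stream_space M" ..
  have "(\<integral>X. f X \<partial>stream_space M) = (\<integral>z. f (case z of (x, X) \<Rightarrow> x ## X) \<partial>(M \<Otimes>\<^sub>M stream_space M))"
    by (subst stream_space_eq_distr_Stream, subst integral_distr) simp_all
  also have "\<dots> = (\<integral>x. (\<integral>X. f (x ## X) \<partial>stream_space M) \<partial>M)"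
    by (subst P.integral_fst'[symmetric])
      (auto intro!: P.P.integrable_const_bound[where B=C] simp: bd)
  finally show ?thesis .
qed

text \<open>Both factors are countable and discrete, so the product sigma-algebra is the power set.
  Strategies enter \<open>run_state\<close> as arbitrary functions of the history, and this makes
  each stage measurable.\<close>

lemma measurable_count_space_pair_pmf:
  "measurable N (count_space (UNIV :: 'b::countable set) \<Otimes>\<^sub>M measure_pmf (r :: 'c::countable pmf))
     = measurable N (count_space UNIV)"
  by (intro measurable_cong_sets refl)
    (subst sets_pair_measure_cong[OF refl sets_measure_pmf_count_space],
      subst pair_measure_countable, auto)

lemma measurable_count_space_any: "f \<in> measurable (count_space UNIV) (count_space UNIV)"
  by simp

locale pomdp =
  fixes q :: "'k::finite \<Rightarrow> 'a::finite \<Rightarrow> ('k \<times> 's::finite) pmf"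
    and g :: "'k \<Rightarrow> 'a \<Rightarrow> real"
  assumes g_nonneg: "0 \<le> g k a" and g_le_1: "g k a \<le> 1"
begin

definition Q :: "('k \<times> ('a, 's) strategy \<Rightarrow> real) \<Rightarrow> 'k \<times> ('a, 's) strategy \<Rightarrow> real" where
  "Q \<phi> = (\<lambda>(k, \<sigma>). \<Sum>z\<in>UNIV. pmf (q k (\<sigma> [])) z * \<phi> (fst z, after \<sigma> (snd z)))"

definition rew :: "'k \<times> ('a, 's) strategy \<Rightarrow> real" where
  "rew = (\<lambda>(k, \<sigma>). g k (\<sigma> []))"

abbreviation noise :: "('k \<times> 'a \<Rightarrow> 'k \<times> 's) stream measure" where
  "noise \<equiv> stream_space (measure_pmf (trans_pmf q))"

abbreviation plays :: "('k \<times> 'a \<times> 's) stream measure" where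
  "plays \<equiv> stream_space (count_space UNIV)"

sublocale noise: prob_space noise
  by (rule prob_space.prob_space_stream_space[OF measure_pmf.prob_space_axioms])

lemma measurable_noise_snth:
  fixes r :: "'k \<times> ('k \<times> 'a \<Rightarrow> 'k \<times> 's) stream \<Rightarrow> 'k \<times> ('a \<times> 's) list"
  assumes [measurable]: "r \<in> measurable (measure_pmf p \<Otimes>\<^sub>M noise) (count_space UNIV)"
  shows "(\<lambda>z. (r z, snd z !! n)) \<in> measurable (measure_pmf p \<Otimes>\<^sub>M noise) (count_space UNIV)"
  unfolding measurable_count_space_pair_pmf[symmetric, where r="trans_pmf q"]
  by (rule measurable_Pair, rule assms, rule measurable_compose[OF measurable_snd measurable_snth])

lemma measurable_run_state:
  "(\<lambda>z. run_state \<sigma> (fst z) (snd z) n) \<in> measurable (measure_pmf p \<Otimes>\<^sub>M noise) (count_space UNIV)"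
proof (induction n)
  case 0
  show ?case by simp
next
  case (Suc n)
  have "(\<lambda>z. run_state \<sigma> (fst z) (snd z) (Suc n)) =
    (\<lambda>(r, F). let (k, h) = r; a = \<sigma> h; (k', s) = F (k, a) in (k', h @ [(a, s)])) \<circ>
     (\<lambda>z. (run_state \<sigma> (fst z) (snd z) n, snd z !! n))"
    by (rule ext) (simp only: run_state.simps comp_apply prod.case)
  also have "\<dots> \<in> measurable (measure_pmf p \<Otimes>\<^sub>M noise) (count_space UNIV)"
    by (rule measurable_comp[OF measurable_noise_snth[OF Suc]]) (rule measurable_count_space_any)
  finally show ?case .
qed

lemma measurable_play:
  "(\<lambda>z. play \<sigma> (fst z) (snd z)) \<in> measurable (measure_pmf p \<Otimes>\<^sub>M noise) plays"
proof (rule measurable_stream_space2)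
  fix n
  have "(\<lambda>z. play \<sigma> (fst z) (snd z) !! n) =
    (\<lambda>(r, F). let (k, h) = r; a = \<sigma> h; (_, s) = F (k, a) in (k, a, s)) \<circ>
     (\<lambda>z. (run_state \<sigma> (fst z) (snd z) n, snd z !! n))"
    by (rule ext) (simp add: play_def to_stream_def)
  also have "\<dots> \<in> measurable (measure_pmf p \<Otimes>\<^sub>M noise) (count_space UNIV)"
    by (rule measurable_comp[OF measurable_noise_snth[OF measurable_run_state]])
      (rule measurable_count_space_any)
  finally show "(\<lambda>z. play \<sigma> (fst z) (snd z) !! n) \<in>
      measurable (measure_pmf p \<Otimes>\<^sub>M noise) (count_space UNIV)" .
qed

lemma measurable_play_snd [measurable]:
  "play \<sigma> k \<in> measurable noise plays"
proof -
  have "(\<lambda>fs. (k, fs)) \<in> measurable noise (measure_pmf (return_pmf k) \<Otimes>\<^sub>M noise)"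
    by (rule measurable_Pair) (simp_all add: measurable_ident_sets)
  from measurable_compose[OF this measurable_play[of \<sigma>]] show ?thesis by (simp only: fst_conv snd_conv)
qed

definition Exp :: "(('k \<times> 'a \<times> 's) stream \<Rightarrow> real) \<Rightarrow> 'k \<times> ('a, 's) strategy \<Rightarrow> real" where
  "Exp F = (\<lambda>(k, \<sigma>). \<integral>fs. F (play \<sigma> k fs) \<partial>noise)"

text \<open>Conditioning on the first noise function: only its value at
  \<open>(k, \<sigma> [])\<close> affects the play, and that coordinate of the product pmf has law
  \<open>q k (\<sigma> [])\<close>.\<close>

lemma Exp_step:
  assumes F [measurable]: "F \<in> borel_measurable plays" and bd: "\<And>\<omega>. \<bar>F \<omega>\<bar> \<le> C"
  shows "Exp F (k, \<sigma>) = (\<Sum>z\<in>UNIV. pmf (q k (\<sigma> [])) z *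
     Exp (\<lambda>\<omega>. F ((k, \<sigma> [], snd z) ## \<omega>)) (fst z, after \<sigma> (snd z)))"
proof -
  define G where "G = (\<lambda>z. Exp (\<lambda>\<omega>. F ((k, \<sigma> [], snd z) ## \<omega>)) (fst z, after \<sigma> (snd z)))"
  have marg: "map_pmf (\<lambda>f. f (k, \<sigma> [])) (trans_pmf q) = q k (\<sigma> [])"
    unfolding trans_pmf_def by (subst Pi_pmf_component) auto
  have "Exp F (k, \<sigma>) = (\<integral>f. (\<integral>fs. F (play \<sigma> k (f ## fs)) \<partial>noise) \<partial>measure_pmf (trans_pmf q))"
    unfolding Exp_def prod.case
    by (rule prob_space.integral_stream_space[OF measure_pmf.prob_space_axioms, where C=C],
        rule measurable_compose[OF measurable_play_snd F], rule bd)
  also have "\<dots> = (\<integral>f. G (f (k, \<sigma> [])) \<partial>measure_pmf (trans_pmf q))"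
    unfolding G_def Exp_def prod.case
    by (subst play_Stream[OF prod.collapse[symmetric]], rule refl)
  also have "\<dots> = (\<integral>z. G z \<partial>measure_pmf (q k (\<sigma> [])))"
    by (subst marg[symmetric]) simp
  also have "\<dots> = (\<Sum>z\<in>UNIV. pmf (q k (\<sigma> [])) z * G z)"
    by (subst integral_measure_pmf[where A=UNIV]) simp_all
  finally show ?thesis unfolding G_def .
qed

end

section \<open>Long-run payoff\<close>

context pomdp
begin

section \<open>Pathwise averages and prefix independence\<close>

definition cum :: "nat \<Rightarrow> ('k \<times> 'a \<times> 's) stream \<Rightarrow> real" where
  "cum n \<omega> = (\<Sum>m<n. g (fst (\<omega> !! m)) (fst (snd (\<omega> !! m))))"

lemma cum_0 [simp]: "cum 0 \<omega> = 0"
  by (simp add: cum_def)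

lemma cum_Stream: "cum (Suc n) (x ## \<omega>) = g (fst x) (fst (snd x)) + cum n \<omega>"
  unfolding cum_def by (subst sum.lessThan_Suc_shift) simp

lemma cum_nonneg: "0 \<le> cum n \<omega>"
  by (auto simp: cum_def intro!: sum_nonneg g_nonneg)

lemma cum_le: "cum n \<omega> \<le> n"
  using sum_bounded_above[of "{..<n}" "\<lambda>m. g (fst (\<omega> !! m)) (fst (snd (\<omega> !! m)))" 1]
  by (simp add: cum_def g_le_1)

lemma measurable_cum [measurable]: "cum n \<in> borel_measurable plays"
  unfolding cum_def by measurable

lemma cum_avg_bounds: "0 \<le> cum (Suc n) \<omega> / Suc n" "cum (Suc n) \<omega> / Suc n \<le> 1"
  using cum_nonneg[of "Suc n" \<omega>] cum_le[of "Suc n" \<omega>] by (simp_all add: field_simps)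

lemma abs_cum_le: "\<bar>cum n \<omega>\<bar> \<le> n"
  using cum_nonneg[of n \<omega>] cum_le[of n \<omega>] by simp

text \<open>\<open>real_of_ereal\<close> loses nothing: the averages lie in [0,1], hence so does
  their liminf.\<close>

lemma ereal_liminf_avg: "ereal (liminf_avg g \<omega>) = liminf (\<lambda>n. ereal (cum (Suc n) \<omega> / Suc n))"
  and liminf_avg_bounds: "0 \<le> liminf_avg g \<omega>" "liminf_avg g \<omega> \<le> 1"
proof -
  let ?l = "liminf (\<lambda>n. ereal (cum (Suc n) \<omega> / Suc n))"
  have 0: "0 \<le> ?l"
    by (rule Liminf_bounded) (use cum_avg_bounds(1) in auto)
  have "?l \<le> liminf (\<lambda>n::nat. 1)"
    by (rule Liminf_mono) (use cum_avg_bounds(2) in auto)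
  then have 1: "?l \<le> 1" by (simp add: Liminf_const)
  from 0 1 obtain r where r: "?l = ereal r" by (cases ?l) auto
  have "liminf_avg g \<omega> = real_of_ereal ?l"
    unfolding liminf_avg_def cum_def by simp
  with r show "ereal (liminf_avg g \<omega>) = ?l" by simp
  with 0 1 show "0 \<le> liminf_avg g \<omega>" "liminf_avg g \<omega> \<le> 1"
    by (metis ereal_less_eq(3) zero_ereal_def, metis ereal_less_eq(3) one_ereal_def)
qed

lemma liminf_avg_geI:
  assumes "eventually (\<lambda>n. c \<le> cum (Suc n) \<omega> / Suc n) sequentially"
  shows "c \<le> liminf_avg g \<omega>"
proof -
  have "ereal c \<le> ereal (liminf_avg g \<omega>)"
    unfolding ereal_liminf_avg by (rule Liminf_bounded) (use assms in simp)
  then show ?thesis by simp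
qed

lemma liminf_avg_gtD:
  assumes "c < liminf_avg g \<omega>"
  shows "eventually (\<lambda>n. c < cum (Suc n) \<omega> / Suc n) sequentially"
proof -
  have "ereal c < liminf (\<lambda>n. ereal (cum (Suc n) \<omega> / Suc n))"
    using assms by (simp only: ereal_liminf_avg[symmetric] less_ereal.simps)
  then show ?thesis
    by (auto dest!: less_LiminfD)
qed

lemma measurable_liminf_avg [measurable]: "liminf_avg g \<in> borel_measurable plays"
proof -
  have "liminf_avg g = (\<lambda>\<omega>. real_of_ereal (liminf (\<lambda>n. ereal (cum (Suc n) \<omega> / Suc n))))"
    unfolding ereal_liminf_avg[symmetric] by simp
  also have "\<dots> \<in> borel_measurable plays" by measurable
  finally show ?thesis .
qed

text \<open>Prepending a reward \<open>r\<close> to an average \<open>A\<close> changes it by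
  \<open>r - A\<close> divided by the new length, and both numbers lie in [0,1].\<close>

lemma cum_avg_Stream:
  "\<bar>cum (Suc (Suc n)) (x ## \<omega>) / Suc (Suc n) - cum (Suc n) \<omega> / Suc n\<bar> \<le> 1 / Suc (Suc n)"
proof -
  define A where "A = cum (Suc n) \<omega> / Suc n"
  have A: "0 \<le> A" "A \<le> 1" using cum_avg_bounds[of n \<omega>] by (simp_all add: A_def)
  have "cum (Suc n) \<omega> = Suc n * A" by (simp add: A_def)
  then have "cum (Suc (Suc n)) (x ## \<omega>) = g (fst x) (fst (snd x)) + Suc n * A"
    by (simp add: cum_Stream)
  then have "cum (Suc (Suc n)) (x ## \<omega>) / Suc (Suc n) - A = (g (fst x) (fst (snd x)) - A) / Suc (Suc n)"
    by (simp add: field_simps)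
  moreover have "\<bar>g (fst x) (fst (snd x)) - A\<bar> \<le> 1"
    using g_nonneg[of "fst x" "fst (snd x)"] g_le_1[of "fst x" "fst (snd x)"] A by (simp add: abs_le_iff)
  ultimately show ?thesis
    unfolding A_def[symmetric] by (simp add: divide_right_mono)
qed

text \<open>A margin between \<open>c\<close> and \<open>c'\<close> eventually absorbs the
  difference of the two averages. This prefix independence makes \<open>pay\<close> harmonic for
  \<open>Q\<close>.\<close>

lemma liminf_avg_Stream:
  fixes \<omega> :: "('k \<times> 'a \<times> 's) stream"
  shows "liminf_avg g (x ## \<omega>) = liminf_avg g \<omega>"
proof (rule antisym)
  have small: "eventually (\<lambda>n. 1 / real (Suc (Suc n)) < e) sequentially" if "e > 0" for e
    using that by real_asymp
  show "liminf_avg g \<omega> \<le> liminf_avg g (x ## \<omega>)"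
  proof (rule dense_le)
    fix c assume "c < liminf_avg g \<omega>"
    then obtain c' where c': "c < c'" "c' < liminf_avg g \<omega>" using dense by blast
    have "eventually (\<lambda>n. c \<le> cum (Suc (Suc n)) (x ## \<omega>) / Suc (Suc n)) sequentially"
      using liminf_avg_gtD[OF c'(2)] small[OF iffD2[OF diff_gt_0_iff_gt c'(1)]]
    proof (eventually_elim)
      case (elim n)
      then show ?case using cum_avg_Stream[of n x \<omega>] by linarith
    qed
    then show "c \<le> liminf_avg g (x ## \<omega>)"
      by (intro liminf_avg_geI
          iffD1[OF eventually_sequentially_Suc[of "\<lambda>n. c \<le> cum (Suc n) (x ## \<omega>) / Suc n"]])
  qed
  show "liminf_avg g (x ## \<omega>) \<le> liminf_avg g \<omega>"
  proof (rule dense_le)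
    fix c assume "c < liminf_avg g (x ## \<omega>)"
    then obtain c' where c': "c < c'" "c' < liminf_avg g (x ## \<omega>)" using dense by blast
    have "eventually (\<lambda>n. c' < cum (Suc (Suc n)) (x ## \<omega>) / Suc (Suc n)) sequentially"
      by (intro liminf_avg_gtD[OF c'(2)]
          iffD2[OF eventually_sequentially_Suc[of "\<lambda>n. c' < cum (Suc n) (x ## \<omega>) / Suc n"]])
    then have "eventually (\<lambda>n. c \<le> cum (Suc n) \<omega> / Suc n) sequentially"
      using small[OF iffD2[OF diff_gt_0_iff_gt c'(1)]]
    proof (eventually_elim)
      case (elim n)
      then show ?case using cum_avg_Stream[of n x \<omega>] by linarith
    qed
    then show "c \<le> liminf_avg g \<omega>" by (rule liminf_avg_geI)
  qed
qed

lemma abs_liminf_avg_le: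
  fixes \<omega> :: "('k \<times> 'a \<times> 's) stream"
  shows "\<bar>liminf_avg g \<omega>\<bar> \<le> 1"
  using liminf_avg_bounds[of \<omega>] by simp

definition pay :: "'k \<times> ('a, 's) strategy \<Rightarrow> real" where
  "pay = Exp (liminf_avg g)"

lemma pay_step: "pay x = Q pay x"
proof (cases x)
  case (Pair k \<sigma>)
  show ?thesis
    unfolding Pair pay_def Q_def prod.case
    by (rule Exp_step[OF measurable_liminf_avg abs_liminf_avg_le, unfolded liminf_avg_Stream])
qed

lemma integrable_bounded_play:
  fixes F :: "('k \<times> 'a \<times> 's) stream \<Rightarrow> real"
  assumes [measurable]: "F \<in> borel_measurable plays" and "\<And>\<omega>. \<bar>F \<omega>\<bar> \<le> C"
  shows "integrable noise (\<lambda>fs. F (play \<sigma> k fs))"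
proof (rule noise.integrable_const_bound[where B=C])
  show "AE fs in noise. norm (F (play \<sigma> k fs)) \<le> C"
    unfolding real_norm_def by (rule AE_I2, rule assms(2))
  show "(\<lambda>fs. F (play \<sigma> k fs)) \<in> borel_measurable noise"
    by (rule measurable_compose[OF measurable_play_snd assms(1)])
qed

lemma integrable_liminf_avg: "integrable noise (\<lambda>fs. liminf_avg g (play \<sigma> k fs))"
  by (rule integrable_bounded_play[OF measurable_liminf_avg abs_liminf_avg_le])

lemma pay_nonneg: "0 \<le> pay x"
  unfolding pay_def Exp_def split_beta
  by (rule integral_nonneg_AE, rule AE_I2, rule liminf_avg_bounds)

lemma pay_le_1: "pay x \<le> 1"
  unfolding pay_def Exp_def split_beta
  by (rule noise.integral_le_const, rule integrable_liminf_avg, rule AE_I2, rule liminf_avg_bounds)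

lemma payoff_inf_eq: "payoff_inf q g p \<sigma> = (\<Sum>k\<in>UNIV. pmf p k * pay (k, \<sigma>))"
proof -
  interpret P: pair_prob_space "measure_pmf p" noise ..
  note measurable_play [measurable]
  have "payoff_inf q g p \<sigma> = (\<integral>z. liminf_avg g (play \<sigma> (fst z) (snd z)) \<partial>(measure_pmf p \<Otimes>\<^sub>M noise))"
    unfolding payoff_inf_def plays_law_def split_beta by (subst integral_distr) auto
  also have "\<dots> = (\<integral>k. (\<integral>fs. liminf_avg g (play \<sigma> (fst (k, fs)) (snd (k, fs))) \<partial>noise) \<partial>measure_pmf p)"
    by (rule P.integral_fst'[symmetric], rule P.P.integrable_const_bound[where B=1])
      (simp_all add: abs_liminf_avg_le)
  also have "\<dots> = (\<integral>k. pay (k, \<sigma>) \<partial>measure_pmf p)"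
    by (simp add: pay_def Exp_def)
  also have "\<dots> = (\<Sum>k\<in>UNIV. pmf p k * pay (k, \<sigma>))"
    by (subst integral_measure_pmf[where A=UNIV]) auto
  finally show ?thesis .
qed

section \<open>Expected totals and Laplace transforms\<close>

fun tot :: "nat \<Rightarrow> 'k \<times> ('a, 's) strategy \<Rightarrow> real" where
  "tot 0 = (\<lambda>x. 0)"
| "tot (Suc n) = (\<lambda>x. rew x + Q (tot n) x)"

text \<open>The Laplace transform of \<open>cum n\<close> (see \<open>Exp_exp_cum\<close>), as
  \<open>tot n\<close> is its expectation. The recursion through \<open>Q\<close> keeps the block
  estimates away from path space.\<close>

fun mgf :: "real \<Rightarrow> nat \<Rightarrow> 'k \<times> ('a, 's) strategy \<Rightarrow> real" where
  "mgf t 0 = (\<lambda>x. 1)"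
| "mgf t (Suc n) = (\<lambda>x. exp (- t * rew x) * Q (mgf t n) x)"

lemma sum_pmf_UNIV [simp]: "(\<Sum>z\<in>UNIV. pmf (p :: 'b::finite pmf) z) = 1"
  by (simp add: sum_pmf_eq_1)

lemma Exp_cum: "Exp (cum n) x = tot n x"
proof (induction n arbitrary: x)
  case 0
  show ?case by (cases x) (simp add: Exp_def)
next
  case (Suc n)
  obtain k \<sigma> where x: "x = (k, \<sigma>)" by (cases x)
  have *: "Exp (\<lambda>\<omega>. c + cum n \<omega>) y = c + tot n y" for c y
  proof -
    obtain k' \<tau> where y: "y = (k', \<tau>)" by (cases y)
    have "integrable noise (\<lambda>fs. cum n (play \<tau> k' fs))"
      by (rule integrable_bounded_play[OF _ abs_cum_le]) simp
    then have "Exp (\<lambda>\<omega>. c + cum n \<omega>) y = c + Exp (cum n) y"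
      by (simp add: Exp_def y noise.prob_space)
    then show ?thesis by (simp only: Suc.IH)
  qed
  show ?case
    unfolding x
    by (subst Exp_step[OF _ abs_cum_le], simp)
      (simp add: cum_Stream * Q_def rew_def distrib_left sum.distrib flip: sum_distrib_right)
qed

lemma Exp_exp_cum:
  assumes "t \<ge> 0"
  shows "Exp (\<lambda>\<omega>. exp (- t * cum n \<omega>)) x = mgf t n x"
proof (induction n arbitrary: x)
  case 0
  show ?case by (cases x) (simp add: Exp_def noise.prob_space)
next
  case (Suc n)
  obtain k \<sigma> where x: "x = (k, \<sigma>)" by (cases x)
  have *: "Exp (\<lambda>\<omega>. c * exp (- t * cum n \<omega>)) y = c * Exp (\<lambda>\<omega>. exp (- t * cum n \<omega>)) y" for c y
    unfolding Exp_def by (cases y) simp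
  have eq: "exp (- t * (r + s)) = exp (- t * r) * exp (- t * s)" for r s
    by (simp add: algebra_simps flip: exp_add)
  show ?case
    unfolding x
    by (subst Exp_step[where C=1])
      (simp_all only: cum_Stream eq * Suc.IH Q_def rew_def prod.case fst_conv snd_conv mgf.simps,
        simp_all add: assms cum_nonneg sum_distrib_left mult.left_commute)
qed

lemma abs_min_avg_le:
  fixes \<omega> :: "('k \<times> 'a \<times> 's) stream"
  shows "\<bar>min (cum (Suc n) \<omega> / Suc n) (liminf_avg g \<omega>)\<bar> \<le> 1"
  using cum_avg_bounds[of n \<omega>] liminf_avg_bounds[of \<omega>] by linarith

text \<open>The minimum of the running average and the liminf converges boundedly to the liminf, so
  dominated convergence applies; its expectation is at most that of the running average.\<close>

lemma pay_eventually_le: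
  assumes "c < pay x"
  shows "eventually (\<lambda>n. c < tot (Suc n) x / Suc n) sequentially"
proof -
  obtain k \<sigma> where x: "x = (k, \<sigma>)" by (cases x)
  let ?L = "\<lambda>fs. liminf_avg g (play \<sigma> k fs)"
  let ?B = "\<lambda>n fs. min (cum (Suc n) (play \<sigma> k fs) / Suc n) (?L fs)"
  have lim: "(\<lambda>n. \<integral>fs. ?B n fs \<partial>noise) \<longlonglongrightarrow> (\<integral>fs. ?L fs \<partial>noise)"
  proof (rule integral_dominated_convergence[where w="\<lambda>_. 1"])
    show "AE fs in noise. (\<lambda>n. ?B n fs) \<longlonglongrightarrow> ?L fs"
    proof (rule AE_I2)
      fix fs
      show "(\<lambda>n. ?B n fs) \<longlonglongrightarrow> ?L fs"
      proof (rule order_tendstoI)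
        fix a assume "a < ?L fs"
        then show "eventually (\<lambda>n. a < ?B n fs) sequentially"
          using liminf_avg_gtD[of a "play \<sigma> k fs"] by simp
      next
        fix a assume "?L fs < a"
        then show "eventually (\<lambda>n. ?B n fs < a) sequentially"
          by (simp add: min_less_iff_disj)
      qed
    qed
    show "AE fs in noise. norm (?B n fs) \<le> 1" for n
      using abs_min_avg_le by (intro AE_I2) simp
  qed auto
  have "eventually (\<lambda>n. c < (\<integral>fs. ?B n fs \<partial>noise)) sequentially"
    by (rule order_tendstoD(1)[OF lim]) (use assms in \<open>simp add: x pay_def Exp_def\<close>)
  then show ?thesis
  proof eventually_elim
    case (elim n)
    have "integrable noise (\<lambda>fs. cum (Suc n) (play \<sigma> k fs))"
      by (rule integrable_bounded_play[OF _ abs_cum_le]) simp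
    moreover have "integrable noise (\<lambda>fs. ?B n fs)"
      by (rule integrable_bounded_play[where F="\<lambda>\<omega>. min (cum (Suc n) \<omega> / Suc n) (liminf_avg g \<omega>)" and C=1])
        (measurable, rule abs_min_avg_le)
    ultimately have "(\<integral>fs. ?B n fs \<partial>noise) \<le> (\<integral>fs. cum (Suc n) (play \<sigma> k fs) / Suc n \<partial>noise)"
      by (intro integral_mono) auto
    also have "\<dots> = tot (Suc n) x / Suc n"
      unfolding Exp_cum[symmetric] by (simp add: Exp_def x)
    finally show ?case using elim by simp
  qed
qed

text \<open>For \<open>c < u\<close>, the exponential Markov inequality bounds the probability of
  \<open>cum n \<le> n * c\<close> by a summable geometric sequence; Borel-Cantelli then gives
  liminf at least \<open>c\<close> almost surely.\<close>

lemma pay_ge_of_mgf: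
  assumes t: "t > 0" and mgf: "\<And>n. mgf t n x \<le> exp (b - t * n * u)"
  shows "u \<le> pay x"
proof (rule dense_le)
  fix c assume c: "c < u"
  obtain k \<sigma> where x: "x = (k, \<sigma>)" by (cases x)
  define A where "A = (\<lambda>n. {fs \<in> space noise. cum n (play \<sigma> k fs) \<le> n * c})"
  have A [measurable]: "A n \<in> sets noise" for n
    unfolding A_def by measurable
  have mA: "measure noise (A n) \<le> exp b * exp (- t * (u - c)) ^ n" for n
  proof -
    have "measure noise (A n) = (\<integral>fs. indicator (A n) fs \<partial>noise)" by simp
    also have "\<dots> \<le> (\<integral>fs. exp (t * n * c) * exp (- t * cum n (play \<sigma> k fs)) \<partial>noise)"
    proof (rule integral_mono)
      show "integrable noise (\<lambda>fs. exp (t * n * c) * exp (- t * cum n (play \<sigma> k fs)))"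
        by (intro integrable_mult_right integrable_bounded_play[where C=1])
          (use t in \<open>auto simp: cum_nonneg\<close>)
      show "indicator (A n) fs \<le> exp (t * n * c) * exp (- t * cum n (play \<sigma> k fs))" for fs
        using t by (auto simp: A_def indicator_def mult.assoc mult_le_cancel_left simp flip: exp_add
           right_diff_distrib)
      show "integrable noise (\<lambda>fs. indicator (A n) fs :: real)"
        by (rule integrable_real_indicator[OF A]) (simp add: noise.emeasure_eq_measure)
    qed
    also have "\<dots> = exp (t * n * c) * mgf t n x"
      unfolding Exp_exp_cum[OF less_imp_le[OF t], symmetric] by (simp add: Exp_def x)
    also have "\<dots> \<le> exp (t * n * c) * exp (b - t * n * u)"
      by (intro mult_left_mono mgf) simp
    also have "\<dots> = exp b * exp (- t * (u - c)) ^ n"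
      by (simp add: algebra_simps flip: exp_add exp_of_nat_mult)
    finally show ?thesis .
  qed
  have "summable (\<lambda>n. measure noise (A n))"
    by (rule summable_comparison_test'[where g="\<lambda>n. exp b * exp (- t * (u - c)) ^ n" and N=0])
      (use mA t c in \<open>auto intro!: summable_mult summable_geometric\<close>)
  then have "AE fs in noise. eventually (\<lambda>n. fs \<in> space noise - A n) sequentially"
    by (intro borel_cantelli_AE1) (auto simp: noise.emeasure_eq_measure)
  then have "AE fs in noise. c \<le> liminf_avg g (play \<sigma> k fs)"
  proof eventually_elim
    case (elim fs)
    then have "eventually (\<lambda>n. fs \<in> space noise - A (Suc n)) sequentially"
      by (rule iffD2[OF eventually_sequentially_Suc[of "\<lambda>n. fs \<in> space noise - A n"]])
    then show ?case
      by (intro liminf_avg_geI, elim eventually_mono) (auto simp: A_def field_simps)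
  qed
  then show "c \<le> pay x"
    unfolding x pay_def Exp_def prod.case
    by (intro noise.integral_ge_const integrable_liminf_avg)
qed

end

section \<open>Banach limits and the transition operator\<close>

text \<open>\<open>L\<close> is a cluster point of the evaluations at \<open>n\<close> in a compact
  product of intervals. Invariance will come from applying \<open>L\<close> to time
  averages.\<close>

lemma banach_limit:
  obtains L :: "(nat \<Rightarrow> real) \<Rightarrow> real" where
    "\<And>x y. Bseq x \<Longrightarrow> Bseq y \<Longrightarrow> L (\<lambda>n. x n + y n) = L x + L y"
    "\<And>x c. Bseq x \<Longrightarrow> L (\<lambda>n. c * x n) = c * L x"
    "\<And>x c. Bseq x \<Longrightarrow> eventually (\<lambda>n. c \<le> x n) sequentially \<Longrightarrow> c \<le> L x"
proof -
  define B where "B = (\<lambda>x :: nat \<Rightarrow> real. SOME C. \<forall>n. \<bar>x n\<bar> \<le> C)"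
  have B: "\<bar>x n\<bar> \<le> B x" if "Bseq x" for x n
  proof -
    from that obtain C where "\<forall>n. \<bar>x n\<bar> \<le> C" by (auto simp: Bseq_def)
    then have "\<forall>n. \<bar>x n\<bar> \<le> B x" unfolding B_def by (rule someI)
    then show ?thesis ..
  qed
  \<comment> \<open>Unbounded sequences are sent to 0, so that every evaluation lies in the compact
    set \<open>K\<close>.\<close>
  define ev where "ev = (\<lambda>n x. if Bseq x then x n else (0::real))"
  define K where "K = (PiE UNIV (\<lambda>x. if Bseq x then {- B x .. B x} else {0}))"
  have "compactin (product_topology (\<lambda>i. euclidean) UNIV) K"
    unfolding K_def by (subst compactin_PiE) auto
  then have K: "compact K" by (simp add: euclidean_product_topology)
  define F where "F = filtermap ev sequentially"
  have "ev n \<in> K" for n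
    using B by (auto simp: ev_def K_def abs_le_iff minus_le_iff)
  then have "eventually (\<lambda>x. x \<in> K) F" by (simp add: F_def eventually_filtermap)
  moreover have "F \<noteq> bot" by (simp add: F_def filtermap_bot_iff)
  ultimately obtain L where L: "inf (nhds L) F \<noteq> bot"
    using K unfolding compact_filter by blast
  \<comment> \<open>A closed condition that holds for all but finitely many evaluations survives at
    the cluster point; each law required of \<open>L\<close>, for fixed sequences, is such a
    condition.\<close>
  have closedD: "P L" if "closed {l. P l}" "eventually (\<lambda>n. P (ev n)) sequentially" for P
  proof (rule ccontr)
    assume "\<not> P L"
    then have "eventually (\<lambda>l. \<not> P l) (nhds L)"
      using that(1) by (auto simp: eventually_nhds closed_def intro!: exI[of _ "- {l. P l}"])
    moreover have "eventually P F" using that(2) by (simp add: F_def eventually_filtermap)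
    ultimately have "eventually (\<lambda>_. False) (inf (nhds L) F)"
      unfolding eventually_inf by blast
    with L show False by (simp add: eventually_False)
  qed
  have cont: "continuous_on UNIV (\<lambda>l :: (nat \<Rightarrow> real) \<Rightarrow> real. l x)" for x
    by (rule continuous_on_product_coordinates)
  show thesis
  proof (rule that[of L])
    fix x y :: "nat \<Rightarrow> real" and c :: real
    assume x: "Bseq x"
    {
      assume y: "Bseq y"
      have "norm (x n + y n) \<le> B x + B y" for n
        unfolding real_norm_def using B[OF x, of n] B[OF y, of n] abs_triangle_ineq[of "x n" "y n"] by linarith
      then have "Bseq (\<lambda>n. x n + y n)" by (rule BseqI')
      then show "L (\<lambda>n. x n + y n) = L x + L y"
        by (intro closedD[of "\<lambda>l. l (\<lambda>n. x n + y n) = l x + l y"] closed_Collect_eq continuous_intros cont) (simp add: ev_def x y)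
    }
    {
      have "Bseq (\<lambda>n. c * x n)" using x by (cases "c = 0") (simp_all add: Bseq_cmult_iff)
      then show "L (\<lambda>n. c * x n) = c * L x"
        by (intro closedD[of "\<lambda>l. l (\<lambda>n. c * x n) = c * l x"] closed_Collect_eq continuous_intros cont) (simp add: ev_def x)
    }
    {
      assume "eventually (\<lambda>n. c \<le> x n) sequentially"
      then show "c \<le> L x"
        by (intro closedD[of "\<lambda>l. c \<le> l x"] closed_Collect_le continuous_intros cont) (simp add: ev_def x)
    }
  qed
qed

definition bdd :: "('x \<Rightarrow> real) \<Rightarrow> bool" where
  "bdd \<phi> \<longleftrightarrow> (\<exists>C. \<forall>x. \<bar>\<phi> x\<bar> \<le> C)"

lemma bddI: "(\<And>x. \<bar>\<phi> x\<bar> \<le> C) \<Longrightarrow> bdd \<phi>"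
  unfolding bdd_def by blast

lemma bdd_const [simp]: "bdd (\<lambda>x. c)"
  by (rule bddI[of _ "\<bar>c\<bar>"]) simp

lemma bdd_add [simp]: assumes "bdd \<phi>" "bdd \<psi>" shows "bdd (\<lambda>x. \<phi> x + \<psi> x)"
proof -
  from assms obtain C D where "\<And>x. \<bar>\<phi> x\<bar> \<le> C" "\<And>x. \<bar>\<psi> x\<bar> \<le> D" by (auto simp: bdd_def)
  then show ?thesis
    by (intro bddI[of _ "C + D"]) (meson abs_triangle_ineq add_mono order_trans)
qed

lemma bdd_mult [simp]: assumes "bdd \<phi>" "bdd \<psi>" shows "bdd (\<lambda>x. \<phi> x * \<psi> x)"
proof -
  from assms obtain C D where C: "\<And>x. \<bar>\<phi> x\<bar> \<le> C" and D: "\<And>x. \<bar>\<psi> x\<bar> \<le> D" by (auto simp: bdd_def)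
  have "0 \<le> C" by (rule order_trans[OF abs_ge_zero C])
  then show ?thesis
    by (intro bddI[of _ "C * D"]) (simp only: abs_mult, intro mult_mono C D abs_ge_zero)
qed

lemma bdd_diff [simp]: "bdd \<phi> \<Longrightarrow> bdd \<psi> \<Longrightarrow> bdd (\<lambda>x. \<phi> x - \<psi> x)"
  using bdd_add[of \<phi> "\<lambda>x. (- 1) * \<psi> x"] bdd_mult[of "\<lambda>x. - 1" \<psi>] by simp

lemma bdd_power2 [simp]: "bdd \<phi> \<Longrightarrow> bdd (\<lambda>x. (\<phi> x)\<^sup>2)"
  by (simp add: power2_eq_square)

lemma bdd_divide [simp]: "bdd \<phi> \<Longrightarrow> bdd (\<lambda>x. \<phi> x / c)"
  using bdd_mult[of "\<lambda>x. 1 / c" \<phi>] by simp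

lemma bdd_sum [simp]: "(\<And>i. i \<in> I \<Longrightarrow> bdd (\<phi> i)) \<Longrightarrow> bdd (\<lambda>x. \<Sum>i\<in>I. \<phi> i x)"
  by (induction I rule: infinite_finite_induct) simp_all

context pomdp
begin

section \<open>Linearity, monotonicity and Jensen inequalities for the transition operator\<close>

lemma Q_Pair: "Q \<phi> (k, \<sigma>) = (\<Sum>z\<in>UNIV. pmf (q k (\<sigma> [])) z * \<phi> (fst z, after \<sigma> (snd z)))"
  by (simp add: Q_def)

lemma Q_add: "Q (\<lambda>x. \<phi> x + \<psi> x) = (\<lambda>x. Q \<phi> x + Q \<psi> x)"
  by (auto simp: Q_def distrib_left sum.distrib)

lemma Q_cmult: "Q (\<lambda>x. c * \<phi> x) = (\<lambda>x. c * Q \<phi> x)"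
  by (auto simp: Q_def sum_distrib_left mult_ac)

lemma Q_const [simp]: "Q (\<lambda>x. c) = (\<lambda>x. c)"
  by (auto simp: Q_def simp flip: sum_distrib_right)

lemma Q_diff: "Q (\<lambda>x. \<phi> x - \<psi> x) = (\<lambda>x. Q \<phi> x - Q \<psi> x)"
  using Q_add[of \<phi> "\<lambda>x. (- 1) * \<psi> x"] Q_cmult[of "- 1" \<psi>] by simp

lemma Q_divide: "Q (\<lambda>x. \<phi> x / c) = (\<lambda>x. Q \<phi> x / c)"
  using Q_cmult[of "1 / c" \<phi>] by simp

lemma Q_sum: "Q (\<lambda>x. \<Sum>i\<in>I. \<phi> i x) = (\<lambda>x. \<Sum>i\<in>I. Q (\<phi> i) x)"
  by (induction I rule: infinite_finite_induct) (simp_all add: Q_add)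

lemma Q_mono: "(\<And>x. \<phi> x \<le> \<psi> x) \<Longrightarrow> Q \<phi> x \<le> Q \<psi> x"
  by (cases x) (auto simp: Q_def intro!: sum_mono mult_left_mono)

lemma Q_le: "(\<And>x. \<phi> x \<le> c) \<Longrightarrow> Q \<phi> x \<le> c"
  using Q_mono[of \<phi> "\<lambda>_. c" x] by simp

lemma Q_ge: "(\<And>x. c \<le> \<phi> x) \<Longrightarrow> c \<le> Q \<phi> x"
  using Q_mono[of "\<lambda>_. c" \<phi> x] by simp

lemma bdd_Q [simp]: "bdd \<phi> \<Longrightarrow> bdd (Q \<phi>)"
proof -
  assume "bdd \<phi>"
  then obtain C where "\<And>x. \<bar>\<phi> x\<bar> \<le> C" by (auto simp: bdd_def)
  then show ?thesis
    by (intro bddI[of _ C]) (auto simp: abs_le_iff minus_le_iff intro!: Q_le Q_ge)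
qed

lemma Q_variance: "Q (\<lambda>y. (\<phi> y - Q \<phi> x)\<^sup>2) x = Q (\<lambda>y. (\<phi> y)\<^sup>2) x - (Q \<phi> x)\<^sup>2"
proof -
  have "(\<lambda>y. (\<phi> y - Q \<phi> x)\<^sup>2) = (\<lambda>y. ((\<phi> y)\<^sup>2 - (2 * Q \<phi> x) * \<phi> y) + (Q \<phi> x)\<^sup>2)"
    by (simp add: power2_eq_square algebra_simps)
  then show ?thesis
    by (simp only: Q_add Q_diff Q_cmult Q_const) (simp add: power2_eq_square)
qed

lemma Q_power2: "(Q \<phi> x)\<^sup>2 \<le> Q (\<lambda>y. (\<phi> y)\<^sup>2) x"
  using Q_variance[of \<phi> x] Q_ge[of 0 "\<lambda>y. (\<phi> y - Q \<phi> x)\<^sup>2" x] by simp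

lemma Qn_add: "(Q ^^ n) (\<lambda>x. \<phi> x + \<psi> x) = (\<lambda>x. (Q ^^ n) \<phi> x + (Q ^^ n) \<psi> x)"
  by (induction n) (simp_all add: Q_add)

lemma Qn_cmult: "(Q ^^ n) (\<lambda>x. c * \<phi> x) = (\<lambda>x. c * (Q ^^ n) \<phi> x)"
  by (induction n) (simp_all add: Q_cmult)

lemma Qn_divide: "(Q ^^ n) (\<lambda>x. \<phi> x / c) = (\<lambda>x. (Q ^^ n) \<phi> x / c)"
  by (induction n) (simp_all add: Q_divide)

lemma Qn_sum: "(Q ^^ n) (\<lambda>x. \<Sum>i\<in>I. \<phi> i x) = (\<lambda>x. \<Sum>i\<in>I. (Q ^^ n) (\<phi> i) x)"
  by (induction n) (simp_all add: Q_sum)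

lemma Qn_le: "(\<And>x. \<phi> x \<le> c) \<Longrightarrow> (Q ^^ n) \<phi> x \<le> c"
  by (induction n arbitrary: x) (simp_all add: Q_le)

lemma Qn_ge: "(\<And>x. c \<le> \<phi> x) \<Longrightarrow> c \<le> (Q ^^ n) \<phi> x"
  by (induction n arbitrary: x) (simp_all add: Q_ge)

lemma bdd_Qn [simp]: "bdd \<phi> \<Longrightarrow> bdd ((Q ^^ n) \<phi>)"
  by (induction n) simp_all

lemma Qn_power2: "((Q ^^ n) \<phi> x)\<^sup>2 \<le> (Q ^^ n) (\<lambda>y. (\<phi> y)\<^sup>2) x"
proof (induction n arbitrary: x)
  case (Suc n)
  have "(Q ((Q ^^ n) \<phi>) x)\<^sup>2 \<le> Q (\<lambda>y. ((Q ^^ n) \<phi> y)\<^sup>2) x" by (rule Q_power2)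
  also have "\<dots> \<le> Q ((Q ^^ n) (\<lambda>y. (\<phi> y)\<^sup>2)) x" by (rule Q_mono) (rule Suc)
  finally show ?case by simp
qed simp

lemma rew_bounds: "0 \<le> rew x" "rew x \<le> 1"
  by (cases x, simp add: rew_def g_nonneg g_le_1)+

lemma bdd_rew [simp]: "bdd rew"
  by (rule bddI[of _ 1]) (simp add: rew_bounds)

lemma tot_eq: "tot n = (\<lambda>x. \<Sum>i<n. (Q ^^ i) rew x)"
proof (induction n)
  case (Suc n)
  show ?case
    by (simp add: Suc Q_sum sum.lessThan_Suc_shift del: sum.lessThan_Suc)
qed simp

lemma tot_nonneg: "0 \<le> tot n x"
  by (auto simp: tot_eq intro!: sum_nonneg Qn_ge rew_bounds)

lemma tot_le: "tot n x \<le> n"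
  using sum_bounded_above[of "{..<n}" "\<lambda>i. (Q ^^ i) rew x" 1] by (auto simp: tot_eq Qn_le rew_bounds)

lemma bdd_tot [simp]: "bdd (tot n)"
  by (rule bddI[of _ n]) (simp add: tot_nonneg tot_le)

section \<open>Expected averages and Cesaro means\<close>

definition avg :: "nat \<Rightarrow> 'k \<times> ('a, 's) strategy \<Rightarrow> real" where
  "avg n x = tot n x / n"

lemma avg_bounds: "0 \<le> avg n x" "avg n x \<le> 1"
  using tot_nonneg[of n x] tot_le[of n x] by (auto simp: avg_def divide_le_eq_1)

lemma bdd_avg [simp]: "bdd (avg n)"
  by (rule bddI[of _ 1]) (simp add: avg_bounds)

text \<open>Applying \<open>Q\<close> shifts the sum of expected rewards by one stage, so only the
  first and the new last term differ.\<close>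

lemma abs_Q_avg_diff: "n > 0 \<Longrightarrow> \<bar>Q (avg n) x - avg n x\<bar> \<le> 1 / n"
proof -
  assume n: "n > 0"
  have "rew x + Q (tot n) x = tot n x + (Q ^^ n) rew x"
    using fun_cong[OF tot_eq[of "Suc n"], of x] fun_cong[OF tot_eq[of n], of x] by simp
  then have "Q (tot n) x - tot n x = (Q ^^ n) rew x - rew x" by simp
  moreover have "\<bar>(Q ^^ n) rew x - rew x\<bar> \<le> 1"
    using rew_bounds[of x] Qn_le[of rew 1 n x, OF rew_bounds(2)] Qn_ge[of 0 rew n x, OF rew_bounds(1)] by linarith
  moreover have "Q (avg n) x - avg n x = (Q (tot n) x - tot n x) / n"
    unfolding avg_def[abs_def] Q_divide by (simp add: diff_divide_distrib)
  ultimately show ?thesis by (simp add: divide_right_mono)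
qed

definition cesaro :: "nat \<Rightarrow> ('k \<times> ('a, 's) strategy \<Rightarrow> real) \<Rightarrow> 'k \<times> ('a, 's) strategy \<Rightarrow> real" where
  "cesaro R \<phi> x = (\<Sum>i<R. (Q ^^ i) \<phi> x) / R"

text \<open>For each \<open>i < n\<close>, the sum of \<open>R\<close> iterates starting from
  \<open>(Q ^^ i) rew\<close> differs from \<open>tot R\<close> in \<open>i\<close> terms at either
  end, hence by at most \<open>n\<close>. The total discrepancy \<open>n * n\<close> is divided by
  \<open>n * R\<close>.\<close>

lemma cesaro_avg_diff:
  assumes n: "n > 0" and R: "R > 0"
  shows "\<bar>cesaro R (avg n) x - avg R x\<bar> \<le> n / R"
proof -
  have "\<bar>(\<Sum>j<R. (Q ^^ j) ((Q ^^ i) rew) x) - tot R x\<bar> \<le> n" if i: "i < n" for i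
  proof -
    have "(\<Sum>j<R. (Q ^^ j) ((Q ^^ i) rew) x) = (\<Sum>j<R. (Q ^^ (i + j)) rew x)"
      by (simp add: funpow_add add.commute[of i])
    also have "\<dots> = (\<Sum>j<i+R. (Q ^^ j) rew x) - (\<Sum>j<i. (Q ^^ j) rew x)"
      by (induction R) simp_all
    also have "(\<Sum>j<i+R. (Q ^^ j) rew x) = (\<Sum>j<R+i. (Q ^^ j) rew x)"
      by (simp add: add.commute)
    also have "\<dots> = tot R x + (\<Sum>j<i. (Q ^^ R) ((Q ^^ j) rew) x)"
      unfolding tot_eq by (induction i) (simp_all add: funpow_add)
    also have "(\<Sum>j<i. (Q ^^ R) ((Q ^^ j) rew) x) = (Q ^^ R) (tot i) x"
      by (simp add: tot_eq Qn_sum)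
    finally have "(\<Sum>j<R. (Q ^^ j) ((Q ^^ i) rew) x) - tot R x = (Q ^^ R) (tot i) x - tot i x"
      by (simp add: tot_eq)
    moreover have "0 \<le> (Q ^^ R) (tot i) x" "(Q ^^ R) (tot i) x \<le> i"
      by (auto intro!: Qn_ge Qn_le tot_nonneg tot_le)
    ultimately show ?thesis
      using tot_nonneg[of i x] tot_le[of i x] i by linarith
  qed
  then have "\<bar>\<Sum>i<n. (\<Sum>j<R. (Q ^^ j) ((Q ^^ i) rew) x) - tot R x\<bar> \<le> (\<Sum>i<n. real n)"
    by (intro order_trans[OF sum_abs] sum_mono) auto
  moreover have "(\<Sum>j<R. (Q ^^ j) (tot n) x) = (\<Sum>i<n. \<Sum>j<R. (Q ^^ j) ((Q ^^ i) rew) x)"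
    unfolding tot_eq Qn_sum by (rule sum.swap)
  ultimately have "\<bar>(\<Sum>j<R. (Q ^^ j) (tot n) x) - n * tot R x\<bar> \<le> real n * real n"
    by (simp add: sum_subtractf)
  moreover have "cesaro R (avg n) x - avg R x = ((\<Sum>j<R. (Q ^^ j) (tot n) x) - n * tot R x) / (n * R)"
    using n R unfolding cesaro_def avg_def[abs_def] Qn_divide
    by (simp add: field_simps flip: sum_divide_distrib)
  ultimately have "\<bar>cesaro R (avg n) x - avg R x\<bar> \<le> (real n * real n) / (n * R)"
    by (simp only: abs_divide abs_of_nat abs_mult of_nat_mult) (rule divide_right_mono, assumption, simp)
  then show ?thesis using n by simp
qed

text \<open>Jensen over \<open>i < R\<close> and within each iterate. It makes
  \<open>cesaro R\<close> a contraction in the seminorm of an invariant mean.\<close>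

lemma cesaro_power2: "(cesaro R \<phi> x)\<^sup>2 \<le> cesaro R (\<lambda>y. (\<phi> y)\<^sup>2) x"
proof (cases "R = 0")
  case False
  have "(\<Sum>i<R. (Q ^^ i) \<phi> x)\<^sup>2 \<le> (\<Sum>i<R. ((Q ^^ i) \<phi> x)\<^sup>2) * card {..<R}"
    by (rule sum_squared_le_sum_of_squares)
  also have "\<dots> \<le> (\<Sum>i<R. (Q ^^ i) (\<lambda>y. (\<phi> y)\<^sup>2) x) * R"
    by (auto intro!: mult_right_mono sum_mono Qn_power2)
  finally show ?thesis
    using False by (simp add: cesaro_def power_divide field_simps power2_eq_square)
qed (simp add: cesaro_def)

lemma cesaro_bounds: "(\<And>x. 0 \<le> \<phi> x) \<Longrightarrow> 0 \<le> cesaro R \<phi> x"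
  "(\<And>x. \<phi> x \<le> 1) \<Longrightarrow> cesaro R \<phi> x \<le> 1"
proof -
  assume "\<And>x. 0 \<le> \<phi> x"
  then show "0 \<le> cesaro R \<phi> x"
    unfolding cesaro_def by (intro divide_nonneg_nonneg sum_nonneg Qn_ge) simp_all
next
  assume "\<And>x. \<phi> x \<le> 1"
  then have "(\<Sum>i<R. (Q ^^ i) \<phi> x) \<le> of_nat (card {..<R}) * 1"
    by (intro sum_bounded_above Qn_le)
  then show "cesaro R \<phi> x \<le> 1" by (auto simp: cesaro_def divide_le_eq_1)
qed

lemma cesaro_half_sum: "cesaro R (\<lambda>x. (\<phi> x + \<psi> x) / 2) x = (cesaro R \<phi> x + cesaro R \<psi> x) / 2"
proof -
  have "(\<Sum>i<R. (a i + b i) / 2) = ((\<Sum>i<R. a i) + (\<Sum>i<R. b i)) / (2::real)" for a b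
    by (simp only: sum.distrib sum_divide_distrib[symmetric])
  then show ?thesis
    unfolding cesaro_def Qn_divide Qn_add by (simp only: add_divide_distrib divide_divide_eq_left mult.commute)
qed

end

section \<open>Invariant means and the mean ergodic theorem\<close>

lemma abs_diff_half_sum_le:
  fixes r u v X :: real
  assumes "\<bar>u - r\<bar> \<le> X" "\<bar>v - r\<bar> \<le> X"
  shows "\<bar>r - (u + v) / 2\<bar> \<le> X"
proof -
  have "- (2 * X) \<le> u + v - 2 * r" "u + v - 2 * r \<le> 2 * X"
    using assms by linarith+
  then show ?thesis by (simp add: abs_le_iff field_simps)
qed

lemma square_diff_parallelogram:
  fixes a b :: real
  shows "(a - b)\<^sup>2 = 2 * a\<^sup>2 + 2 * b\<^sup>2 - 4 * ((a + b) / 2)\<^sup>2"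
proof -
  have "4 * ((a + b) / 2)\<^sup>2 = (a + b)\<^sup>2" by (simp add: power_divide)
  then show ?thesis by (simp add: power2_sum power2_diff)
qed

lemma ex_nat_div_less: "e > 0 \<Longrightarrow> \<exists>R0>0. \<forall>R\<ge>R0. c / real R < e"
proof -
  assume e: "e > 0"
  obtain R0 :: nat where R0: "\<bar>c\<bar> / e < R0" using reals_Archimedean2 by blast
  have "c / real R < e" if "R \<ge> Suc R0" for R
  proof -
    have "\<bar>c\<bar> / e < R" using R0 that by linarith
    then have "\<bar>c\<bar> < e * R" using e by (simp add: divide_less_eq mult.commute)
    then have "c < e * R" by linarith
    then show ?thesis using that by (simp add: divide_less_eq)
  qed
  then show ?thesis by blast
qed

locale invariant_mean = pomdp q g
  for q :: "'k::finite \<Rightarrow> 'a::finite \<Rightarrow> ('k \<times> 's::finite) pmf" and g +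
  fixes \<Lambda> :: "('k \<times> ('a, 's) strategy \<Rightarrow> real) \<Rightarrow> real"
  assumes mean_add: "bdd \<phi> \<Longrightarrow> bdd \<psi> \<Longrightarrow> \<Lambda> (\<lambda>x. \<phi> x + \<psi> x) = \<Lambda> \<phi> + \<Lambda> \<psi>"
    and mean_cmult: "bdd \<phi> \<Longrightarrow> \<Lambda> (\<lambda>x. c * \<phi> x) = c * \<Lambda> \<phi>"
    and mean_nonneg: "bdd \<phi> \<Longrightarrow> (\<And>x. 0 \<le> \<phi> x) \<Longrightarrow> 0 \<le> \<Lambda> \<phi>"
    and mean_one: "\<Lambda> (\<lambda>x. 1) = 1"
    and mean_Q: "bdd \<phi> \<Longrightarrow> \<Lambda> (Q \<phi>) = \<Lambda> \<phi>"
begin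

lemma mean_const [simp]: "\<Lambda> (\<lambda>x. c) = c"
  using mean_cmult[of "\<lambda>x. 1" c] by (simp add: mean_one)

lemma mean_diff: "bdd \<phi> \<Longrightarrow> bdd \<psi> \<Longrightarrow> \<Lambda> (\<lambda>x. \<phi> x - \<psi> x) = \<Lambda> \<phi> - \<Lambda> \<psi>"
  using mean_add[of \<phi> "\<lambda>x. (- 1) * \<psi> x"] mean_cmult[of \<psi> "- 1"] bdd_mult[of "\<lambda>x. - 1" \<psi>] by simp

lemma mean_divide: "bdd \<phi> \<Longrightarrow> \<Lambda> (\<lambda>x. \<phi> x / c) = \<Lambda> \<phi> / c"
  using mean_cmult[of \<phi> "1 / c"] by simp

lemma mean_sum: "(\<And>i. i \<in> I \<Longrightarrow> bdd (\<phi> i)) \<Longrightarrow> \<Lambda> (\<lambda>x. \<Sum>i\<in>I. \<phi> i x) = (\<Sum>i\<in>I. \<Lambda> (\<phi> i))"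
  by (induction I rule: infinite_finite_induct) (simp_all add: mean_add)

lemma mean_mono: "bdd \<phi> \<Longrightarrow> bdd \<psi> \<Longrightarrow> (\<And>x. \<phi> x \<le> \<psi> x) \<Longrightarrow> \<Lambda> \<phi> \<le> \<Lambda> \<psi>"
  using mean_nonneg[of "\<lambda>x. \<psi> x - \<phi> x"] by (simp add: mean_diff)

lemma mean_Qn: "bdd \<phi> \<Longrightarrow> \<Lambda> ((Q ^^ n) \<phi>) = \<Lambda> \<phi>"
  by (induction n) (simp_all add: mean_Q)

lemma mean_avg: "n > 0 \<Longrightarrow> \<Lambda> (avg n) = \<Lambda> rew"
proof -
  assume n: "n > 0"
  have "\<Lambda> (tot n) = n * \<Lambda> rew"
    unfolding tot_eq by (subst mean_sum) (simp_all add: mean_Qn)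
  with n show ?thesis
    using mean_divide[of "tot n" n] by (simp add: avg_def[abs_def])
qed

lemma bdd_cesaro [simp]: "bdd \<phi> \<Longrightarrow> bdd (cesaro R \<phi>)"
  by (simp add: cesaro_def[abs_def])

lemma mean_cesaro: "R > 0 \<Longrightarrow> bdd \<phi> \<Longrightarrow> \<Lambda> (cesaro R \<phi>) = \<Lambda> \<phi>"
  unfolding cesaro_def[abs_def] by (simp add: mean_divide mean_sum mean_Qn)

text \<open>The squared L2 seminorm of the mean.\<close>

abbreviation sqn :: "('k \<times> ('a, 's) strategy \<Rightarrow> real) \<Rightarrow> real" where
  "sqn \<phi> \<equiv> \<Lambda> (\<lambda>x. (\<phi> x)\<^sup>2)"

lemma sqn_cesaro_le: "R > 0 \<Longrightarrow> bdd \<phi> \<Longrightarrow> sqn (cesaro R \<phi>) \<le> sqn \<phi>"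
  using mean_mono[of "\<lambda>x. (cesaro R \<phi> x)\<^sup>2" "cesaro R (\<lambda>y. (\<phi> y)\<^sup>2)"]
  by (simp add: cesaro_power2 mean_cesaro)

lemma sqn_le_add:
  assumes "bdd \<phi>" "bdd \<psi>" "\<And>x. 0 \<le> \<phi> x \<and> \<phi> x \<le> 1" "\<And>x. 0 \<le> \<psi> x \<and> \<psi> x \<le> 1" "\<And>x. \<bar>\<phi> x - \<psi> x\<bar> \<le> e"
  shows "sqn \<phi> \<le> sqn \<psi> + 2 * e"
proof -
  have "(\<phi> x)\<^sup>2 \<le> (\<psi> x)\<^sup>2 + 2 * e" for x
  proof -
    have "(\<phi> x)\<^sup>2 - (\<psi> x)\<^sup>2 = (\<phi> x - \<psi> x) * (\<phi> x + \<psi> x)"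
      by (simp add: power2_eq_square algebra_simps)
    also have "\<dots> \<le> \<bar>\<phi> x - \<psi> x\<bar> * (\<phi> x + \<psi> x)"
      using assms(3,4)[of x] by (intro mult_right_mono) auto
    also have "\<dots> \<le> e * 2"
      using assms(3-5)[of x] by (intro mult_mono) auto
    finally show ?thesis by simp
  qed
  then have "sqn \<phi> \<le> \<Lambda> (\<lambda>x. (\<psi> x)\<^sup>2 + 2 * e)"
    by (intro mean_mono) (simp_all add: assms)
  then show ?thesis by (simp add: mean_add assms)
qed

text \<open>The mean ergodic theorem for the reward: all averages of the orbit have seminorm at least
  the infimum \<open>d\<close>, which \<open>avg n\<close> approaches, so the parallelogram law makes \<open>avg n\<close> Cauchy.\<close>

lemma sqn_avg_Cauchy:
  assumes e: "e > 0"
  obtains N where "N > 0" "\<And>n m. n \<ge> N \<Longrightarrow> m \<ge> N \<Longrightarrow> sqn (\<lambda>x. avg n x - avg m x) \<le> e"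
proof -
  define d where "d = (INF n\<in>{0<..}. sqn (avg n))"
  have bb: "bdd_below ((\<lambda>n. sqn (avg n)) ` {0<..})"
    by (rule bdd_belowI[of _ 0]) (auto intro!: mean_nonneg)
  have d: "d \<le> sqn (avg n)" if "n > 0" for n
    unfolding d_def by (rule cINF_lower[OF bb]) (use that in auto)
  \<comment> \<open>The parallelogram law will give
    \<open>2 * (d + 2 * \<delta>) + 2 * (d + 2 * \<delta>) - 4 * d\<close>, that is
    \<open>8 * \<delta>\<close>.\<close>
  define \<delta> where "\<delta> = e / 8"
  have \<delta>: "\<delta> > 0" using e by (simp add: \<delta>_def)
  have "\<exists>y\<in>(\<lambda>n. sqn (avg n)) ` {0<..}. y < d + \<delta>"
    by (rule cInf_lessD) (use \<delta> in \<open>auto simp: d_def\<close>)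
  then obtain n0 where n0: "n0 > 0" "sqn (avg n0) < d + \<delta>" by auto
  obtain N where N: "N > 0" "\<And>n. n \<ge> N \<Longrightarrow> 2 * real n0 / real n < \<delta>"
    using ex_nat_div_less[OF \<delta>, of "2 * real n0"] by blast
  \<comment> \<open>\<open>avg n\<close> is uniformly close to the Cesaro mean of
    \<open>avg n0\<close>, whose seminorm does not exceed that of \<open>avg n0\<close>.\<close>
  have up: "sqn (avg n) \<le> d + 2 * \<delta>" if n: "n \<ge> N" for n
  proof -
    have "sqn (avg n) \<le> sqn (cesaro n (avg n0)) + 2 * (n0 / n)"
    proof (intro sqn_le_add conjI avg_bounds cesaro_bounds)
      show "\<bar>avg n x - cesaro n (avg n0) x\<bar> \<le> n0 / n" for x
        unfolding abs_minus_commute[of "avg n x"] using n N(1) n0(1) by (intro cesaro_avg_diff) simp_all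
    qed simp_all
    also have "sqn (cesaro n (avg n0)) \<le> sqn (avg n0)"
      using n N(1) by (intro sqn_cesaro_le) auto
    finally show ?thesis using n0(2) N(2)[OF n] by simp
  qed
  \<comment> \<open>The Cesaro mean of the midpoint over a long range \<open>R\<close> is uniformly
    close to \<open>avg R\<close>, where \<open>sqn\<close> is at least \<open>d\<close>.\<close>
  have low: "d \<le> sqn (\<lambda>x. (avg n x + avg m x) / 2)" if nm: "n > 0" "m > 0" for n m
  proof (rule field_le_epsilon)
    fix \<eta> :: real assume \<eta>: "\<eta> > 0"
    obtain R where R: "R > 0" "2 * (real n + real m) / real R < \<eta>"
      using ex_nat_div_less[OF \<eta>, of "2 * (real n + real m)"] by blast
    let ?h = "\<lambda>x. (avg n x + avg m x) / 2"
    have h: "0 \<le> ?h x" "?h x \<le> 1" for x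
      using avg_bounds[of n x] avg_bounds[of m x] by auto
    have close: "\<bar>avg R x - cesaro R ?h x\<bar> \<le> (real n + real m) / R" for x
    proof -
      have "real n / R \<le> (real n + real m) / R" "real m / R \<le> (real n + real m) / R"
        by (simp_all add: divide_right_mono)
      then have "\<bar>cesaro R (avg n) x - avg R x\<bar> \<le> (real n + real m) / R"
        "\<bar>cesaro R (avg m) x - avg R x\<bar> \<le> (real n + real m) / R"
        using cesaro_avg_diff[OF nm(1) R(1), of x] cesaro_avg_diff[OF nm(2) R(1), of x] by linarith+
      then show ?thesis unfolding cesaro_half_sum by (rule abs_diff_half_sum_le)
    qed
    have "d \<le> sqn (avg R)" by (rule d) (rule R)
    also have "\<dots> \<le> sqn (cesaro R ?h) + 2 * ((real n + real m) / R)"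
      by (intro sqn_le_add conjI avg_bounds cesaro_bounds h close) simp_all
    also have "sqn (cesaro R ?h) \<le> sqn ?h"
      by (rule sqn_cesaro_le) (use R in auto)
    finally show "d \<le> sqn ?h + \<eta>" using R(2) by simp
  qed
  show thesis
  proof (rule that[OF N(1)])
    fix n m assume nm: "n \<ge> N" "m \<ge> N"
    have "(\<lambda>x. (avg n x - avg m x)\<^sup>2) =
       (\<lambda>x. 2 * (avg n x)\<^sup>2 + 2 * (avg m x)\<^sup>2 - 4 * ((avg n x + avg m x) / 2)\<^sup>2)"
      by (rule ext) (rule square_diff_parallelogram)
    then have "sqn (\<lambda>x. avg n x - avg m x) =
       2 * sqn (avg n) + 2 * sqn (avg m) - 4 * sqn (\<lambda>x. (avg n x + avg m x) / 2)"
      by (simp only: mean_diff mean_add mean_cmult bdd_power2 bdd_avg bdd_add bdd_mult bdd_const bdd_divide)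
    then show "sqn (\<lambda>x. avg n x - avg m x) \<le> e"
      using up[OF nm(1)] up[OF nm(2)] low[of n m] nm N(1) by (simp add: \<delta>_def)
  qed
qed

text \<open>By invariance the left side is \<open>sqn (avg n) - sqn (Q (avg n))\<close>, and
  \<open>Q (avg n)\<close> lies within \<open>1 / n\<close> of \<open>avg n\<close>.\<close>

lemma mean_variance_avg:
  assumes n: "n > 0"
  shows "\<Lambda> (\<lambda>x. Q (\<lambda>y. (avg n y)\<^sup>2) x - (Q (avg n) x)\<^sup>2) \<le> 2 / n"
proof -
  have "sqn (avg n) \<le> sqn (Q (avg n)) + 2 * (1 / n)"
  proof (intro sqn_le_add conjI avg_bounds Q_ge Q_le)
    show "\<bar>avg n x - Q (avg n) x\<bar> \<le> 1 / n" for x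
      unfolding abs_minus_commute[of "avg n x"] by (rule abs_Q_avg_diff[OF n])
  qed simp_all
  then show ?thesis by (simp add: mean_diff mean_Q)
qed

end

context pomdp
begin

text \<open>\<open>\<Lambda>\<close> is a Banach limit of the time averages of the stage laws. The
  last property leads back from the mean to the strategy: a value above \<open>c\<close> is
  witnessed at some stage \<open>m\<close>.\<close>

lemma ex_invariant_mean:
  fixes p :: "'k pmf" and \<sigma> :: "('a, 's) strategy"
  obtains \<Lambda> where "invariant_mean q g \<Lambda>" "payoff_inf q g p \<sigma> \<le> \<Lambda> rew"
    "\<And>\<phi> c. bdd \<phi> \<Longrightarrow> c < \<Lambda> \<phi> \<Longrightarrow> \<exists>m. c < (\<Sum>k\<in>UNIV. pmf p k * (Q ^^ m) \<phi> (k, \<sigma>))"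
proof -
  obtain L :: "(nat \<Rightarrow> real) \<Rightarrow> real" where
    L_add: "\<And>x y. Bseq x \<Longrightarrow> Bseq y \<Longrightarrow> L (\<lambda>n. x n + y n) = L x + L y" and
    L_cmult: "\<And>x c. Bseq x \<Longrightarrow> L (\<lambda>n. c * x n) = c * L x" and
    L_ge: "\<And>x c. Bseq x \<Longrightarrow> eventually (\<lambda>n. c \<le> x n) sequentially \<Longrightarrow> c \<le> L x"
    by (rule banach_limit) blast
  have L_le: "L x \<le> c" if "Bseq x" "eventually (\<lambda>n. x n \<le> c) sequentially" for x c
    using L_ge[of "\<lambda>n. - 1 * x n" "- c"] L_cmult[of x "- 1"] that by (simp add: Bseq_minus_iff)
  define M where "M = (\<lambda>m \<phi>. \<Sum>k\<in>UNIV. pmf p k * (Q ^^ m) \<phi> (k, \<sigma>))"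
  define A where "A = (\<lambda>\<phi> n. (\<Sum>m<Suc n. M m \<phi>) / real (Suc n))"
  have M_le: "M m \<phi> \<le> c" if "\<And>x. \<phi> x \<le> c" for m \<phi> c
  proof -
    have "M m \<phi> \<le> (\<Sum>k\<in>UNIV. pmf p k * c)"
      unfolding M_def by (intro sum_mono mult_left_mono Qn_le that) simp
    then show ?thesis by (simp flip: sum_distrib_right)
  qed
  have M_ge: "c \<le> M m \<phi>" if "\<And>x. c \<le> \<phi> x" for m \<phi> c
  proof -
    have "M m \<phi> \<ge> (\<Sum>k\<in>UNIV. pmf p k * c)"
      unfolding M_def by (intro sum_mono mult_left_mono Qn_ge that) simp
    then show ?thesis by (simp flip: sum_distrib_right)
  qed
  have A_le: "A \<phi> n \<le> c" if "\<And>m. M m \<phi> \<le> c" for \<phi> n c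
    using sum_bounded_above[of "{..<Suc n}" "\<lambda>m. M m \<phi>" c] that
    by (simp add: A_def divide_le_eq mult.commute)
  have A_ge: "c \<le> A \<phi> n" if "\<And>m. c \<le> M m \<phi>" for \<phi> n c
    using sum_bounded_below[of "{..<Suc n}" c "\<lambda>m. M m \<phi>"] that
    by (simp add: A_def le_divide_eq mult.commute)
  have A_bseq: "Bseq (A \<phi>)" if "bdd \<phi>" for \<phi>
  proof -
    from that obtain C where "\<And>x. \<bar>\<phi> x\<bar> \<le> C" by (auto simp: bdd_def)
    then have "\<And>x. \<phi> x \<le> C" "\<And>x. - C \<le> \<phi> x"
      by (simp_all add: abs_le_iff minus_le_iff)
    then have "norm (A \<phi> n) \<le> C" for n
      using A_le[OF M_le, of \<phi> C n] A_ge[OF M_ge, of "- C" \<phi> n] by (simp add: abs_le_iff)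
    then show ?thesis by (rule BseqI')
  qed
  have A_add: "A (\<lambda>x. \<phi> x + \<psi> x) = (\<lambda>n. A \<phi> n + A \<psi> n)" for \<phi> \<psi>
    unfolding A_def M_def Qn_add
    by (simp only: distrib_left sum.distrib add_divide_distrib)
  have A_cmult: "A (\<lambda>x. c * \<phi> x) = (\<lambda>n. c * A \<phi> n)" for \<phi> c
    unfolding A_def M_def Qn_cmult
    by (simp only: sum_distrib_left mult.left_commute times_divide_eq_right)
  \<comment> \<open>Telescoping leaves boundary terms divided by \<open>Suc n\<close>; for bounded
    functions these vanish in the limit, which gives invariance.\<close>
  have A_Q: "A (Q \<phi>) n - A \<phi> n = (M (Suc n) \<phi> - M 0 \<phi>) / Suc n" for \<phi> n
  proof -
    have "M m (Q \<phi>) = M (Suc m) \<phi>" for m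
      by (simp add: M_def funpow_swap1)
    then have "(\<Sum>m<Suc n. M m (Q \<phi>)) = (\<Sum>m<Suc n. M (Suc m) \<phi>)" by simp
    also have "\<dots> = (\<Sum>m<Suc n. M m \<phi>) + (M (Suc n) \<phi> - M 0 \<phi>)"
      using sum.lessThan_Suc_shift[of "\<lambda>m. M m \<phi>" "Suc n"] by simp
    finally have *: "(\<Sum>m<Suc n. M m (Q \<phi>)) = (\<Sum>m<Suc n. M m \<phi>) + (M (Suc n) \<phi> - M 0 \<phi>)" .
    show ?thesis unfolding A_def * by (simp only: add_divide_distrib add_diff_cancel_left')
  qed
  define \<Lambda> where "\<Lambda> = (\<lambda>\<phi>. L (A \<phi>))"
  have "invariant_mean q g \<Lambda>"
  proof
    fix \<phi> \<psi> :: "'k \<times> ('a, 's) strategy \<Rightarrow> real" and c :: real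
    assume \<phi>: "bdd \<phi>"
    show "\<Lambda> (\<lambda>x. \<phi> x + \<psi> x) = \<Lambda> \<phi> + \<Lambda> \<psi>" if "bdd \<psi>"
      unfolding \<Lambda>_def A_add by (intro L_add A_bseq \<phi> that)
    show "\<Lambda> (\<lambda>x. c * \<phi> x) = c * \<Lambda> \<phi>"
      unfolding \<Lambda>_def A_cmult by (intro L_cmult A_bseq \<phi>)
    show "0 \<le> \<Lambda> \<phi>" if "\<And>x. 0 \<le> \<phi> x"
      unfolding \<Lambda>_def by (intro L_ge A_bseq \<phi> always_eventually allI A_ge M_ge that)
    obtain C where C: "\<And>x. \<bar>\<phi> x\<bar> \<le> C" using \<phi> by (auto simp: bdd_def)
    then have C': "\<And>x. \<phi> x \<le> C" "\<And>x. - C \<le> \<phi> x"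
      by (simp_all add: abs_le_iff minus_le_iff)
    have bd: "\<bar>A (Q \<phi>) n - A \<phi> n\<bar> \<le> 2 * C / Suc n" for n
    proof -
      have "\<bar>M (Suc n) \<phi> - M 0 \<phi>\<bar> \<le> 2 * C"
        using M_le[of \<phi> C "Suc n", OF C'(1)] M_ge[of "- C" \<phi> "Suc n", OF C'(2)]
          M_le[of \<phi> C 0, OF C'(1)] M_ge[of "- C" \<phi> 0, OF C'(2)] by linarith
      then show ?thesis unfolding A_Q abs_divide by (simp add: divide_right_mono)
    qed
    have lim: "(\<lambda>n. A (Q \<phi>) n - A \<phi> n) \<longlonglongrightarrow> 0"
    proof (rule Lim_null_comparison)
      show "eventually (\<lambda>n. norm (A (Q \<phi>) n - A \<phi> n) \<le> 2 * C / Suc n) sequentially"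
        using bd by simp
      show "(\<lambda>n. 2 * C / real (Suc n)) \<longlonglongrightarrow> 0" by real_asymp
    qed
    have B1: "Bseq (A (Q \<phi>))" "Bseq (\<lambda>n. - 1 * A \<phi> n)"
      using A_bseq[of "Q \<phi>"] A_bseq[OF \<phi>] by (simp_all add: \<phi> Bseq_minus_iff)
    have B2: "Bseq (\<lambda>n. A (Q \<phi>) n - A \<phi> n)"
      using lim by (intro convergent_imp_Bseq convergentI)
    have "L (\<lambda>n. A (Q \<phi>) n - A \<phi> n) = \<Lambda> (Q \<phi>) - \<Lambda> \<phi>"
      unfolding \<Lambda>_def using L_add[OF B1] L_cmult[OF A_bseq[OF \<phi>], of "- 1"] by simp
    moreover have "L (\<lambda>n. A (Q \<phi>) n - A \<phi> n) = 0"
    proof (rule antisym)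
      show "L (\<lambda>n. A (Q \<phi>) n - A \<phi> n) \<le> 0"
      proof (rule field_le_epsilon)
        fix e :: real assume "e > 0"
        then have "eventually (\<lambda>n. A (Q \<phi>) n - A \<phi> n < e) sequentially"
          by (rule order_tendstoD(2)[OF lim])
        then show "L (\<lambda>n. A (Q \<phi>) n - A \<phi> n) \<le> 0 + e"
          by (intro L_le B2) (auto elim: eventually_mono)
      qed
      show "0 \<le> L (\<lambda>n. A (Q \<phi>) n - A \<phi> n)"
      proof (rule field_le_epsilon)
        fix e :: real assume "e > 0"
        then have "- e < 0" by simp
        then have "eventually (\<lambda>n. - e < A (Q \<phi>) n - A \<phi> n) sequentially"
          by (rule order_tendstoD(1)[OF lim])
        then have "- e \<le> L (\<lambda>n. A (Q \<phi>) n - A \<phi> n)"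
          by (intro L_ge B2) (auto elim: eventually_mono)
        then show "0 \<le> L (\<lambda>n. A (Q \<phi>) n - A \<phi> n) + e" by simp
      qed
    qed
    ultimately show "\<Lambda> (Q \<phi>) = \<Lambda> \<phi>" by simp
  next
    have *: "A (\<lambda>x. 1) n = 1" for n
      by (intro antisym A_le A_ge M_le M_ge) simp_all
    show "\<Lambda> (\<lambda>x. 1) = 1"
      unfolding \<Lambda>_def by (intro antisym L_le L_ge A_bseq) (simp_all add: *)
  qed
  moreover have "payoff_inf q g p \<sigma> \<le> \<Lambda> rew"
  proof (rule field_le_epsilon)
    fix e :: real assume e: "e > 0"
    have "eventually (\<lambda>n. \<forall>k\<in>UNIV. pay (k, \<sigma>) - e < tot (Suc n) (k, \<sigma>) / Suc n) sequentially"
      by (intro eventually_ball_finite ballI pay_eventually_le) (use e in auto)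
    then have "eventually (\<lambda>n. payoff_inf q g p \<sigma> - e \<le> A rew n) sequentially"
    proof eventually_elim
      case (elim n)
      have "payoff_inf q g p \<sigma> - e = (\<Sum>k\<in>UNIV. pmf p k * (pay (k, \<sigma>) - e))"
        by (simp add: payoff_inf_eq right_diff_distrib sum_subtractf flip: sum_distrib_right)
      also have "\<dots> \<le> (\<Sum>k\<in>UNIV. pmf p k * (tot (Suc n) (k, \<sigma>) / Suc n))"
        using elim by (intro sum_mono mult_left_mono) (auto intro: less_imp_le)
      also have "\<dots> = A rew n"
        unfolding A_def M_def tot_eq
        by (simp only: sum_divide_distrib sum_distrib_left times_divide_eq_right)
          (rule sum.swap)
      finally show ?case .
    qed
    then have "payoff_inf q g p \<sigma> - e \<le> \<Lambda> rew"
      unfolding \<Lambda>_def by (intro L_ge A_bseq) simp_all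
    then show "payoff_inf q g p \<sigma> \<le> \<Lambda> rew + e" by simp
  qed
  moreover have "\<exists>m. c < M m \<phi>" if "bdd \<phi>" "c < \<Lambda> \<phi>" for \<phi> c
  proof (rule ccontr)
    assume "\<nexists>m. c < M m \<phi>"
    then have "M m \<phi> \<le> c" for m by (simp add: not_less)
    then have "\<Lambda> \<phi> \<le> c"
      unfolding \<Lambda>_def by (intro L_le A_bseq that always_eventually allI A_le)
    with that show False by simp
  qed
  ultimately show thesis using that unfolding M_def by blast
qed

end

section \<open>Restarting strategies\<close>

text \<open>The Myhill-Nerode construction: residual strategies, coded as naturals, are the memory
  states, and each plays its value at the empty history.\<close>

lemma finite_memory_if_finite_residuals:
  fixes \<sigma> :: "('a, 's) strategy"
  assumes fin: "finite (range (residual \<sigma>))"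
  shows "finite_memory \<sigma>"
proof -
  obtain enc :: "('a, 's) strategy \<Rightarrow> nat" where enc: "inj_on enc (range (residual \<sigma>))"
    using finite_imp_inj_to_nat_seg[OF fin] by blast
  define dec where "dec = the_inv_into (range (residual \<sigma>)) enc"
  have dec: "dec (enc (residual \<sigma> h)) = residual \<sigma> h" for h
    unfolding dec_def by (rule the_inv_into_f_f[OF enc]) simp
  define \<sigma>u where "\<sigma>u = (\<lambda>x a s. enc (residual (dec x) [(a, s)]))"
  have run: "mem_state \<sigma>u (enc (residual \<sigma> h)) h' = enc (residual \<sigma> (h @ h'))" for h h'
    by (induction h' arbitrary: h) (auto simp: \<sigma>u_def dec)
  show ?thesis
    unfolding finite_memory_def
  proof (intro exI conjI allI ballI)
    show "finite (enc ` range (residual \<sigma>))" using fin by (rule finite_imageI)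
    show "enc (residual \<sigma> []) \<in> enc ` range (residual \<sigma>)" by blast
    show "\<sigma>u x a s \<in> enc ` range (residual \<sigma>)" if "x \<in> enc ` range (residual \<sigma>)" for x a s
      using that by (auto simp: \<sigma>u_def dec)
    show "\<sigma> h = dec (mem_state \<sigma>u (enc (residual \<sigma> [])) h) []" for h
      by (simp only: run dec) (simp add: residual_def)
  qed
qed

lemma finite_histories_less: "finite {h :: ('a::finite \<times> 's::finite) list. length h < n}"
  using finite_lists_length_le[of "UNIV :: ('a \<times> 's) set" n]
  by (rule finite_subset[rotated]) auto

lemma finite_residuals_if_later:
  fixes \<sigma> :: "('a::finite, 's::finite) strategy"
  assumes "\<And>h. length h = m \<Longrightarrow> finite (range (residual (residual \<sigma> h)))"
  shows "finite (range (residual \<sigma>))"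
proof (rule finite_subset)
  show "range (residual \<sigma>) \<subseteq> residual \<sigma> ` {h. length h < m} \<union>
      (\<Union>h\<in>{h. length h = m}. range (residual (residual \<sigma> h)))"
  proof clarify
    fix h assume *: "residual \<sigma> h \<notin> (\<Union>h\<in>{h. length h = m}. range (residual (residual \<sigma> h)))"
    have "length h < m"
    proof (rule ccontr)
      assume "\<not> length h < m"
      then have "length (take m h) = m" "residual \<sigma> h = residual (residual \<sigma> (take m h)) (drop m h)"
        by simp_all
      with * show False by blast
    qed
    then show "residual \<sigma> h \<in> residual \<sigma> ` {h. length h < m}" by simp
  qed
  have "finite {h :: ('a \<times> 's) list. length h = m}"
    by (rule finite_subset[OF _ finite_histories_less[of "Suc m"]]) auto
  then show "finite (residual \<sigma> ` {h. length h < m} \<union>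
      (\<Union>h\<in>{h. length h = m}. range (residual (residual \<sigma> h))))"
    using assms finite_histories_less by auto
qed

text \<open>A memory state \<open>w\<close> stands for all histories with key \<open>w\<close>; \<open>rep w\<close> is one of them.\<close>

function restart :: "('a, 's) strategy \<Rightarrow> ('w \<Rightarrow> ('a \<times> 's) list) \<Rightarrow> (('a \<times> 's) list \<Rightarrow> 'w)
    \<Rightarrow> nat \<Rightarrow> 'w \<Rightarrow> ('a, 's) strategy" where
  "restart \<sigma> rep key M w h = (if length h < Suc M then \<sigma> (rep w @ h)
     else restart \<sigma> rep key M (key (rep w @ take (Suc M) h)) (drop (Suc M) h))"
  by pat_completeness auto
text \<open>Blocks have length \<open>Suc M\<close>, so every recursive call strictly shortens the
  history.\<close>

termination by (relation "Wellfounded.measure (\<lambda>(_, _, _, _, _, h). length h)") auto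

declare restart.simps [simp del]

lemma residual_restart:
  assumes "length h = Suc M"
  shows "residual (restart \<sigma> rep key M w) h = restart \<sigma> rep key M (key (rep w @ h))"
proof
  fix h'
  show "residual (restart \<sigma> rep key M w) h h' = restart \<sigma> rep key M (key (rep w @ h)) h'"
    unfolding residual_def by (subst restart.simps) (use assms in simp)
qed

text \<open>Complete blocks lead back to \<open>restart\<close> at some key, so a residual is
  determined by a key and the part of the current block already played.\<close>

lemma finite_residuals_restart:
  fixes \<sigma> :: "('a::finite, 's::finite) strategy"
  assumes fin: "finite (range key)"
  shows "finite (range (residual (restart \<sigma> rep key M (key h0))))"
proof (rule finite_subset)
  let ?\<tau> = "restart \<sigma> rep key M"
  let ?S = "(\<lambda>(w, h). residual (?\<tau> w) h) ` (range key \<times> {h. length h < Suc M})"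
  have "residual (?\<tau> (key h1)) h \<in> ?S" for h1 h
  proof (induction h arbitrary: h1 rule: length_induct)
    case (1 h)
    show ?case
    proof (cases "length h < Suc M")
      case True
      then show ?thesis by (intro image_eqI[of _ _ "(key h1, h)"]) auto
    next
      case False
      then have "residual (?\<tau> (key h1)) h =
          residual (residual (?\<tau> (key h1)) (take (Suc M) h)) (drop (Suc M) h)"
        by simp
      also have "\<dots> = residual (?\<tau> (key (rep (key h1) @ take (Suc M) h))) (drop (Suc M) h)"
        using False by (subst residual_restart) simp_all
      also have "\<dots> \<in> ?S"
        using False by (intro 1[rule_format]) auto
      finally show ?thesis .
    qed
  qed
  then show "range (residual (?\<tau> (key h0))) \<subseteq> ?S" by blast
  show "finite ?S" using fin finite_histories_less by blast
qed

text \<open>Multiply by \<open>exp y\<close>, use \<open>1 + y \<le> exp y\<close> and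
  \<open>(1 + y) * (1 - y + y\<^sup>2) = 1 + y ^ 3\<close>.\<close>

lemma exp_minus_le:
  fixes y :: real
  assumes "0 \<le> y"
  shows "exp (- y) \<le> 1 - y + y\<^sup>2"
proof -
  have "1 \<le> 1 + y ^ 3" using assms by simp
  also have "\<dots> = (1 + y) * (1 - y + y\<^sup>2)"
    by (simp add: power2_eq_square power3_eq_cube algebra_simps)
  also have "\<dots> \<le> exp y * (1 - y + y\<^sup>2)"
  proof (rule mult_right_mono)
    have "0 \<le> (1 - y)\<^sup>2 + y" using assms by simp
    also have "\<dots> = 1 - y + y\<^sup>2" by (simp add: power2_eq_square algebra_simps)
    finally show "0 \<le> 1 - y + y\<^sup>2" .
  qed simp
  finally have "exp (- y) * 1 \<le> exp (- y) * (exp y * (1 - y + y\<^sup>2))"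
    by (intro mult_left_mono) simp_all
  then show ?thesis by (simp flip: mult.assoc exp_add)
qed

section \<open>Reachability and the propagation of exponential moments\<close>

context pomdp
begin

text \<open>The least positive transition probability; the inserted 1 gives
  \<open>qmin \<le> 1\<close> at once.\<close>

definition qmin :: real where
  "qmin = Min (insert 1 ((\<lambda>(k, a, z). pmf (q k a) z) ` {(k, a, z). 0 < pmf (q k a) z}))"

lemma qmin: "0 < qmin" "qmin \<le> 1" "0 < pmf (q k a) z \<Longrightarrow> qmin \<le> pmf (q k a) z"
proof -
  let ?S = "insert 1 ((\<lambda>(k, a, z). pmf (q k a) z) ` {(k, a, z). 0 < pmf (q k a) z})"
  have "qmin \<in> ?S" unfolding qmin_def by (rule Min_in) auto
  then show "0 < qmin" by auto
  show "qmin \<le> 1" unfolding qmin_def by (rule Min_le) auto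
  show "qmin \<le> pmf (q k a) z" if "0 < pmf (q k a) z"
    unfolding qmin_def using that by (intro Min_le finite.insertI finite_imageI finite insertI2 image_eqI[of _ _ "(k, a, z)"]) auto
qed

text \<open>Joint positive probability, from \<open>k\<close> under \<open>\<sigma>\<close>, of the
  history and the final hidden state \<open>k'\<close>.\<close>

fun reach :: "'k \<Rightarrow> ('a, 's) strategy \<Rightarrow> ('a \<times> 's) list \<Rightarrow> 'k \<Rightarrow> bool" where
  "reach k \<sigma> [] k' \<longleftrightarrow> k' = k"
| "reach k \<sigma> (x # h) k' \<longleftrightarrow> fst x = \<sigma> [] \<and>
     (\<exists>k1. 0 < pmf (q k (\<sigma> [])) (k1, snd x) \<and> reach k1 (after \<sigma> (snd x)) h k')"

lemma reach_append:
  "reach k \<sigma> h k' \<Longrightarrow> reach k' (residual \<sigma> h) h' k'' \<Longrightarrow> reach k \<sigma> (h @ h') k''"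
proof (induction k \<sigma> h k' rule: reach.induct)
  case (2 k \<sigma> x h k')
  then obtain k1 where k1: "fst x = \<sigma> []" "0 < pmf (q k (\<sigma> [])) (k1, snd x)" "reach k1 (after \<sigma> (snd x)) h k'"
    by auto
  have "residual \<sigma> (x # h) = residual (after \<sigma> (snd x)) h"
    using residual_Cons[of \<sigma> "snd x" h] k1(1) by (metis prod.collapse)
  then show ?case using 2 k1 by auto
qed simp

text \<open>One path realising \<open>h\<close> and \<open>k'\<close> has probability at least
  \<open>qmin ^ length h\<close>, and nonnegativity of \<open>\<psi>\<close> lets all others be
  dropped. Small expectations thus become bounds at each reachable state.\<close>

lemma reach_lower:
  assumes "\<And>x. 0 \<le> \<psi> x"
  shows "reach k \<sigma> h k' \<Longrightarrow> qmin ^ length h * \<psi> (k', residual \<sigma> h) \<le> (Q ^^ length h) \<psi> (k, \<sigma>)"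
proof (induction k \<sigma> h k' rule: reach.induct)
  case (2 k \<sigma> x h k')
  then obtain k1 where k1: "fst x = \<sigma> []" "0 < pmf (q k (\<sigma> [])) (k1, snd x)" "reach k1 (after \<sigma> (snd x)) h k'"
    by auto
  have eq: "residual \<sigma> (x # h) = residual (after \<sigma> (snd x)) h"
    using residual_Cons[of \<sigma> "snd x" h] k1(1) by (metis prod.collapse)
  have nn: "0 \<le> (Q ^^ length h) \<psi> y" for y by (rule Qn_ge) (rule assms)
  have "qmin ^ length (x # h) * \<psi> (k', residual \<sigma> (x # h)) =
      qmin * (qmin ^ length h * \<psi> (k', residual (after \<sigma> (snd x)) h))"
    by (simp add: eq mult.assoc)
  also have "\<dots> \<le> pmf (q k (\<sigma> [])) (k1, snd x) * (Q ^^ length h) \<psi> (k1, after \<sigma> (snd x))"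
  proof (rule mult_mono)
    show "qmin ^ length h * \<psi> (k', residual (after \<sigma> (snd x)) h) \<le> (Q ^^ length h) \<psi> (k1, after \<sigma> (snd x))"
      using 2 k1 by blast
    show "0 \<le> qmin ^ length h * \<psi> (k', residual (after \<sigma> (snd x)) h)"
      using qmin(1) assms by (simp add: less_imp_le)
  qed (use k1 qmin in auto)
  also have "\<dots> \<le> (\<Sum>z\<in>UNIV. pmf (q k (\<sigma> [])) z * (Q ^^ length h) \<psi> (fst z, after \<sigma> (snd z)))"
    using member_le_sum[of "(k1, snd x)" UNIV "\<lambda>z. pmf (q k (\<sigma> [])) z * (Q ^^ length h) \<psi> (fst z, after \<sigma> (snd z))"]
    by (simp add: nn)
  also have "\<dots> = (Q ^^ length (x # h)) \<psi> (k, \<sigma>)"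
    by (simp add: Q_Pair)
  finally show ?case .
qed simp

lemma mgf_nonneg: "0 \<le> mgf t n x"
  by (induction n arbitrary: x) (auto intro!: Q_ge mult_nonneg_nonneg)

lemma mgf_Suc_le: "0 \<le> t \<Longrightarrow> mgf t (Suc n) x \<le> mgf t n x"
proof (induction n arbitrary: x)
  case 0
  then show ?case by (simp add: rew_bounds)
next
  case (Suc n)
  have "mgf t (Suc (Suc n)) x = exp (- t * rew x) * Q (mgf t (Suc n)) x" by simp
  also have "\<dots> \<le> exp (- t * rew x) * Q (mgf t n) x"
    by (intro mult_left_mono Q_mono Suc.IH Suc.prems) simp
  finally show ?case by simp
qed

lemma mgf_antimono: "0 \<le> t \<Longrightarrow> m \<le> n \<Longrightarrow> mgf t n x \<le> mgf t m x"
  by (rule lift_Suc_antimono_le[of "\<lambda>n. mgf t n x"]) (rule mgf_Suc_le)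

text \<open>By induction: the first reward contributes the factor from \<open>exp_minus_le\<close>,
  and the quadratic errors fit because
  \<open>1 + n + n\<^sup>2 \<le> (Suc n)\<^sup>2\<close>.\<close>

lemma mgf_le_quadratic:
  assumes t: "0 \<le> t"
  shows "t * real n \<le> 1 \<Longrightarrow> mgf t n x \<le> 1 - t * tot n x + (t * n)\<^sup>2"
proof (induction n arbitrary: x)
  case 0
  show ?case by simp
next
  case (Suc n)
  define r where "r = rew x"
  define T where "T = Q (tot n) x"
  have r: "0 \<le> r" "r \<le> 1" by (simp_all add: r_def rew_bounds)
  have T: "0 \<le> T" "T \<le> n" by (simp_all add: T_def Q_ge Q_le tot_nonneg tot_le)
  have t1: "t \<le> 1" and tn: "t * n \<le> 1"
    using Suc.prems t mult_left_mono[of 1 "real (Suc n)" t] mult_left_mono[of n "real (Suc n)" t] by simp_all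
  define A where "A = 1 - t * r + (t * r)\<^sup>2"
  have tr: "0 \<le> t * r" "t * r \<le> 1" using t r t1 by (simp_all add: mult_le_one)
  have A: "A \<le> 1" using tr by (simp add: A_def power2_eq_square mult_left_le)
  have "Q (mgf t n) x \<le> Q (\<lambda>y. (1 - t * tot n y) + (t * n)\<^sup>2) x"
    using tn by (intro Q_mono) (use Suc.IH in auto)
  also have "\<dots> = 1 - t * T + (t * n)\<^sup>2"
    unfolding Q_add Q_diff Q_cmult Q_const T_def by simp
  finally have B: "Q (mgf t n) x \<le> 1 - t * T + (t * n)\<^sup>2" .
  have T1: "0 \<le> 1 - t * T" using mult_left_mono[OF T(2) t] tn by simp
  have "mgf t (Suc n) x = exp (- (t * r)) * Q (mgf t n) x" by (simp add: r_def)
  also have "\<dots> \<le> A * (1 - t * T + (t * n)\<^sup>2)"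
    unfolding A_def using tr T1
    by (intro mult_mono exp_minus_le B) (auto intro!: Q_ge mgf_nonneg add_nonneg_nonneg)
  also have "\<dots> = A * (1 - t * T) + A * (t * n)\<^sup>2" by (simp add: algebra_simps)
  also have "A * (t * n)\<^sup>2 \<le> 1 * (t * n)\<^sup>2" by (rule mult_right_mono[OF A]) simp
  also have "A * (1 - t * T) = 1 - t * (r + T) + t\<^sup>2 * r\<^sup>2 + t\<^sup>2 * (r * T) - (t * r)\<^sup>2 * (t * T)"
    by (simp add: A_def power2_eq_square algebra_simps)
  also have "\<dots> \<le> 1 - t * (r + T) + t\<^sup>2 * 1 + t\<^sup>2 * n"
  proof -
    have "t\<^sup>2 * r\<^sup>2 \<le> t\<^sup>2 * 1" using r by (intro mult_left_mono) (auto simp: power_le_one)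
    moreover have "t\<^sup>2 * (r * T) \<le> t\<^sup>2 * n"
      using r T mult_mono[of r 1 T n] by (intro mult_left_mono) auto
    moreover have "0 \<le> (t * r)\<^sup>2 * (t * T)" using t T by simp
    ultimately show ?thesis by linarith
  qed
  finally have "mgf t (Suc n) x \<le> 1 - t * (r + T) + t\<^sup>2 * 1 + t\<^sup>2 * n + 1 * (t * n)\<^sup>2" by simp
  also have "\<dots> \<le> 1 - t * (r + T) + (t * Suc n)\<^sup>2"
    using t by (simp add: power2_eq_square algebra_simps)
  also have "r + T = tot (Suc n) x" by (simp add: r_def T_def)
  finally show ?case .
qed

text \<open>While \<open>\<tau>\<close> copies \<open>\<sigma>\<close> the recursions for
  \<open>mgf\<close> coincide. The continuation bound \<open>C\<close> is asked only at reachable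
  states because other branches carry weight 0.\<close>

lemma mgf_block:
  assumes "\<And>h. length h < N \<Longrightarrow> \<tau> h = \<sigma> h"
    and "\<And>h k'. length h = N \<Longrightarrow> reach k \<sigma> h k' \<Longrightarrow> mgf t n (k', residual \<tau> h) \<le> C"
  shows "mgf t (N + n) (k, \<tau>) \<le> C * mgf t N (k, \<sigma>)"
  using assms
proof (induction N arbitrary: k \<sigma> \<tau>)
  case 0
  then show ?case using 0(2)[of "[]" k] by simp
next
  case (Suc N)
  have 0: "\<tau> [] = \<sigma> []" by (rule Suc.prems(1)) simp
  have "pmf (q k (\<sigma> [])) z * mgf t (N + n) (fst z, after \<tau> (snd z)) \<le>
      pmf (q k (\<sigma> [])) z * (C * mgf t N (fst z, after \<sigma> (snd z)))" for z
  proof (cases "pmf (q k (\<sigma> [])) z = 0")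
    case False
    then have z: "0 < pmf (q k (\<sigma> [])) z" by (simp add: pmf_nonneg order_less_le)
    have "mgf t (N + n) (fst z, after \<tau> (snd z)) \<le> C * mgf t N (fst z, after \<sigma> (snd z))"
    proof (rule Suc.IH)
      show "after \<tau> (snd z) h = after \<sigma> (snd z) h" if "length h < N" for h
        using that by (simp add: after_def residual_def 0 Suc.prems(1))
      show "mgf t n (k', residual (after \<tau> (snd z)) h) \<le> C"
        if "length h = N" "reach (fst z) (after \<sigma> (snd z)) h k'" for h k'
      proof -
        have "reach k \<sigma> ((\<sigma> [], snd z) # h) k'"
          using that z by (auto intro!: exI[of _ "fst z"])
        then have "mgf t n (k', residual \<tau> ((\<tau> [], snd z) # h)) \<le> C"
          unfolding 0 using that by (intro Suc.prems(2)) simp_all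
        then show ?thesis by (simp only: residual_Cons)
      qed
    qed
    then show ?thesis by (rule mult_left_mono) simp
  qed simp
  then have "Q (mgf t (N + n)) (k, \<tau>) \<le> C * Q (mgf t N) (k, \<sigma>)"
    unfolding Q_Pair 0 sum_distrib_left by (intro sum_mono) (simp add: mult.left_commute)
  then have "exp (- t * rew (k, \<sigma>)) * Q (mgf t (N + n)) (k, \<tau>) \<le> exp (- t * rew (k, \<sigma>)) * (C * Q (mgf t N) (k, \<sigma>))"
    by (rule mult_left_mono) simp
  then show ?case by (simp add: rew_def 0 mult.left_commute)
qed

text \<open>\<open>pay\<close> is harmonic, so a lower bound at stage \<open>m\<close> pulls back
  through the stages on which the strategies agree.\<close>

lemma pay_switch:
  assumes "\<And>h. length h < m \<Longrightarrow> \<tau> h = \<sigma> h"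
    and "\<And>h k'. length h = m \<Longrightarrow> \<phi> (k', residual \<sigma> h) \<le> pay (k', residual \<tau> h)"
  shows "(Q ^^ m) \<phi> (k, \<sigma>) \<le> pay (k, \<tau>)"
  using assms
proof (induction m arbitrary: k \<sigma> \<tau>)
  case 0
  then show ?case using 0(2)[of "[]" k] by simp
next
  case (Suc m)
  have 0: "\<tau> [] = \<sigma> []" by (rule Suc.prems(1)) simp
  have "(Q ^^ m) \<phi> (fst z, after \<sigma> (snd z)) \<le> pay (fst z, after \<tau> (snd z))" for z
  proof (rule Suc.IH)
    show "after \<tau> (snd z) h = after \<sigma> (snd z) h" if "length h < m" for h
      using that by (simp add: after_def residual_def 0 Suc.prems(1))
    show "\<phi> (k', residual (after \<sigma> (snd z)) h) \<le> pay (k', residual (after \<tau> (snd z)) h)"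
      if "length h = m" for h k'
    proof -
      have "\<phi> (k', residual \<sigma> ((\<sigma> [], snd z) # h)) \<le> pay (k', residual \<tau> ((\<tau> [], snd z) # h))"
        unfolding 0 using that by (intro Suc.prems(2)) simp
      then show ?thesis by (simp only: residual_Cons)
    qed
  qed
  then have "Q ((Q ^^ m) \<phi>) (k, \<sigma>) \<le> Q pay (k, \<tau>)"
    unfolding Q_Pair 0 by (intro sum_mono mult_left_mono) auto
  then show ?case by (simp flip: pay_step)
qed

end

text \<open>Sequential compactness of the strategy space, in the form of Koenig's lemma on the tree of
  finite-horizon restrictions.\<close>

lemma strategy_compactness:
  fixes P :: "('a::finite, 's::finite) strategy \<Rightarrow> nat \<Rightarrow> bool"
  assumes mono: "\<And>\<sigma> I J. P \<sigma> I \<Longrightarrow> I \<le> J \<Longrightarrow> P \<sigma> J"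
    and loc: "\<And>\<sigma>. \<exists>d I. \<forall>\<sigma>'. (\<forall>h. length h < d \<longrightarrow> \<sigma>' h = \<sigma> h) \<longrightarrow> P \<sigma>' I"
  shows "\<exists>I. \<forall>\<sigma>. P \<sigma> I"
proof (rule ccontr)
  assume contr: "\<nexists>I. \<forall>\<sigma>. P \<sigma> I"
  define agree where "agree = (\<lambda>d \<sigma> \<sigma>' :: ('a, 's) strategy. \<forall>h. length h < d \<longrightarrow> \<sigma>' h = \<sigma> h)"
  \<comment> \<open>The cylinder of depth \<open>d\<close> around \<open>\<sigma>\<close> admits no
    common bound \<open>I\<close>.\<close>
  define bad where "bad = (\<lambda>d \<sigma>. \<forall>I. \<exists>\<sigma>'. agree d \<sigma> \<sigma>' \<and> \<not> P \<sigma>' I)"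
  have bad0: "bad 0 \<sigma>" for \<sigma> using contr by (auto simp: bad_def agree_def)
  have step: "\<exists>\<sigma>'. bad (Suc d) \<sigma>' \<and> agree d \<sigma> \<sigma>'" if bad: "bad d \<sigma>" for d \<sigma>
  proof (rule ccontr)
    assume "\<nexists>\<sigma>'. bad (Suc d) \<sigma>' \<and> agree d \<sigma> \<sigma>'"
    then have "\<forall>\<sigma>'. \<exists>I. agree d \<sigma> \<sigma>' \<longrightarrow> (\<forall>\<sigma>''. agree (Suc d) \<sigma>' \<sigma>'' \<longrightarrow> P \<sigma>'' I)"
      unfolding bad_def by blast
    then obtain I where I: "\<And>\<sigma>' \<sigma>''. agree d \<sigma> \<sigma>' \<Longrightarrow> agree (Suc d) \<sigma>' \<sigma>'' \<Longrightarrow> P \<sigma>'' (I \<sigma>')"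
      by (metis (no_types, lifting))
    \<comment> \<open>The subcylinders of depth \<open>Suc d\<close> are finitely many, so the
      maximum of their bounds would serve the whole cylinder.\<close>
    define r where "r = (\<lambda>\<sigma>' :: ('a, 's) strategy. restrict \<sigma>' {h. length h < Suc d})"
    define A where "A = {\<sigma>'. agree d \<sigma> \<sigma>'}"
    define rep where "rep = inv_into A r"
    have rep: "rep (r \<sigma>') \<in> A" "r (rep (r \<sigma>')) = r \<sigma>'" if "\<sigma>' \<in> A" for \<sigma>'
      using that by (simp_all add: rep_def inv_into_into f_inv_into_f)
    have "finite (r ` A)"
      by (rule finite_subset[of _ "PiE {h. length h < Suc d} (\<lambda>_. UNIV)"])
        (auto simp: r_def intro!: finite_PiE finite_histories_less split: if_splits)
    then have fin: "finite ((\<lambda>c. I (rep c)) ` r ` A)" by simp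
    obtain \<sigma>' where \<sigma>': "agree d \<sigma> \<sigma>'" "\<not> P \<sigma>' (Max ((\<lambda>c. I (rep c)) ` r ` A))"
      using bad unfolding bad_def by blast
    then have A: "\<sigma>' \<in> A" by (simp add: A_def)
    have "agree (Suc d) (rep (r \<sigma>')) \<sigma>'"
      using rep(2)[OF A] unfolding agree_def r_def
      by (metis (mono_tags, lifting) mem_Collect_eq restrict_apply')
    then have "P \<sigma>' (I (rep (r \<sigma>')))"
      using rep(1)[OF A] I by (simp add: A_def)
    moreover have "I (rep (r \<sigma>')) \<le> Max ((\<lambda>c. I (rep c)) ` r ` A)"
      using A by (intro Max_ge[OF fin]) blast
    ultimately show False using mono \<sigma>'(2) by blast
  qed
  obtain s where s: "\<And>n. bad n (s n)" "\<And>n. agree n (s n) (s (Suc n))"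
    using dependent_nat_choice[of bad agree] bad0 step by metis
  have chain: "agree n (s n) (s (n + j))" for n j
  proof (induction j)
    case (Suc j)
    then show ?case using s(2)[of "n + j"] by (auto simp: agree_def)
  qed (simp add: agree_def)
  \<comment> \<open>The value at \<open>h\<close> is frozen from index \<open>Suc (length h)\<close>
    on, so this limit agrees with \<open>s n\<close> on histories shorter than
    \<open>n\<close>.\<close>
  define \<sigma> where "\<sigma> = (\<lambda>h. s (Suc (length h)) h)"
  have "s n h = \<sigma> h" if "length h < n" for n h
    using chain[of "Suc (length h)" "n - Suc (length h)"] that by (simp add: agree_def \<sigma>_def)
  then have ag: "agree n (s n) \<sigma>'' \<Longrightarrow> \<forall>h. length h < n \<longrightarrow> \<sigma>'' h = \<sigma> h" for n \<sigma>''
    by (simp add: agree_def)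
  obtain d I where "\<forall>\<sigma>'. (\<forall>h. length h < d \<longrightarrow> \<sigma>' h = \<sigma> h) \<longrightarrow> P \<sigma>' I"
    using loc by blast
  then show False using s(1)[of d] ag unfolding bad_def by blast
qed

text \<open>Increments are controlled only from \<open>j\<close> on because, at a state reached by a
  history, the penalties bound them only from the length of that history on.\<close>

lemma geometric_Cauchy:
  fixes a :: "nat \<Rightarrow> real"
  assumes step: "\<And>i. i \<ge> j \<Longrightarrow> \<bar>a i - a (Suc i)\<bar> \<le> c * (1 / 2) ^ i" and c: "0 \<le> c"
  shows "convergent a" "\<bar>a j - lim a\<bar> \<le> 2 * c"
proof -
  have bound: "\<bar>a m - a (m + n)\<bar> \<le> 2 * c * ((1 / 2) ^ m - (1 / 2) ^ (m + n))" if "m \<ge> j" for m n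
  proof (induction n)
    case (Suc n)
    have "\<bar>a (m + n) - a (Suc (m + n))\<bar> \<le> c * (1 / 2) ^ (m + n)"
      using that by (intro step) simp
    moreover have "2 * c * (1 / 2) ^ (m + Suc n) = c * (1 / 2) ^ (m + n)" by simp
    ultimately show ?case using Suc by (simp only: right_diff_distrib add_Suc_right)
  qed simp
  have bound': "\<bar>a m - a n\<bar> \<le> 2 * c * (1 / 2) ^ m" if "m \<ge> j" "n \<ge> m" for m n
  proof -
    have "\<bar>a m - a n\<bar> \<le> 2 * c * ((1 / 2) ^ m - (1 / 2) ^ n)"
      using bound[OF that(1), of "n - m"] that by simp
    also have "\<dots> \<le> 2 * c * (1 / 2) ^ m"
      using c by (intro mult_left_mono) simp_all
    finally show ?thesis .
  qed
  have "Cauchy a"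
  proof (rule metric_CauchyI)
    fix e :: real assume e: "e > 0"
    have "(\<lambda>m. 2 * c * (1 / 2) ^ m) \<longlonglongrightarrow> 2 * c * 0"
      by (intro tendsto_mult_left LIMSEQ_power_zero) simp
    then have "eventually (\<lambda>m. 2 * c * (1 / 2) ^ m < e / 2) sequentially"
      using e by (intro order_tendstoD(2)[of _ 0]) simp_all
    then obtain M0 where M0: "\<And>m. m \<ge> M0 \<Longrightarrow> 2 * c * (1 / 2) ^ m < e / 2"
      by (auto simp: eventually_sequentially)
    define M where "M = max M0 j"
    have "dist (a m) (a n) < e" if "m \<ge> M" "n \<ge> M" for m n
    proof -
      have "\<bar>a M - a m\<bar> < e / 2" "\<bar>a M - a n\<bar> < e / 2"
        using bound'[of M m] bound'[of M n] M0[of M] that by (auto simp: M_def)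
      then show ?thesis unfolding dist_real_def by linarith
    qed
    then show "\<exists>M. \<forall>m\<ge>M. \<forall>n\<ge>M. dist (a m) (a n) < e" by blast
  qed
  then show conv: "convergent a" by (rule Cauchy_convergent)
  then have "(\<lambda>n. \<bar>a j - a n\<bar>) \<longlonglongrightarrow> \<bar>a j - lim a\<bar>"
    by (intro tendsto_intros) (simp add: convergent_LIMSEQ_iff)
  moreover have "eventually (\<lambda>n. \<bar>a j - a n\<bar> \<le> 2 * c) sequentially"
  proof (rule eventually_sequentiallyI)
    fix n assume "n \<ge> j"
    then have "\<bar>a j - a n\<bar> \<le> 2 * c * (1 / 2) ^ j" by (intro bound') simp_all
    also have "\<dots> \<le> 2 * c" using c by (intro mult_left_le power_le_one) simp_all
    finally show "\<bar>a j - a n\<bar> \<le> 2 * c" .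
  qed
  ultimately show "\<bar>a j - lim a\<bar> \<le> 2 * c"
    by (rule tendsto_upperbound) simp
qed

section \<open>Finite-horizon functions and the payoff of restarted strategies\<close>

context pomdp
begin

text \<open>The horizon \<open>d\<close> is uniform in the strategy; such functions are constant on
  cylinders, which supplies the local hypothesis of \<open>strategy_compactness\<close>.\<close>

definition finite_horizon :: "('k \<times> ('a, 's) strategy \<Rightarrow> real) \<Rightarrow> bool" where
  "finite_horizon \<phi> \<longleftrightarrow>
    (\<exists>d. \<forall>k \<sigma> \<sigma>'. (\<forall>h. length h < d \<longrightarrow> \<sigma>' h = \<sigma> h) \<longrightarrow> \<phi> (k, \<sigma>') = \<phi> (k, \<sigma>))"

lemma finite_horizon_const: "finite_horizon (\<lambda>x. c)"
  by (simp add: finite_horizon_def)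

lemma finite_horizon_combine:
  assumes "finite_horizon \<phi>" "finite_horizon \<psi>"
  shows "finite_horizon (\<lambda>x. F (\<phi> x) (\<psi> x))"
proof -
  obtain d where d: "\<And>k \<sigma> \<sigma>'. (\<forall>h. length h < d \<longrightarrow> \<sigma>' h = \<sigma> h) \<Longrightarrow> \<phi> (k, \<sigma>') = \<phi> (k, \<sigma>)"
    using assms(1) unfolding finite_horizon_def by blast
  obtain e where e: "\<And>k \<sigma> \<sigma>'. (\<forall>h. length h < e \<longrightarrow> \<sigma>' h = \<sigma> h) \<Longrightarrow> \<psi> (k, \<sigma>') = \<psi> (k, \<sigma>)"
    using assms(2) unfolding finite_horizon_def by blast
  show ?thesis
    unfolding finite_horizon_def
  proof (intro exI allI impI)
    fix k and \<sigma> \<sigma>' :: "('a, 's) strategy"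
    assume "\<forall>h. length h < max d e \<longrightarrow> \<sigma>' h = \<sigma> h"
    then have "\<phi> (k, \<sigma>') = \<phi> (k, \<sigma>)" "\<psi> (k, \<sigma>') = \<psi> (k, \<sigma>)"
      by (auto intro!: d e)
    then show "F (\<phi> (k, \<sigma>')) (\<psi> (k, \<sigma>')) = F (\<phi> (k, \<sigma>)) (\<psi> (k, \<sigma>))" by simp
  qed
qed

lemma finite_horizon_comp: "finite_horizon \<phi> \<Longrightarrow> finite_horizon (\<lambda>x. F (\<phi> x))"
  using finite_horizon_combine[of \<phi> \<phi> "\<lambda>u v. F u"] by simp

lemma finite_horizon_sum:
  "(\<And>i. i \<in> I \<Longrightarrow> finite_horizon (\<phi> i)) \<Longrightarrow> finite_horizon (\<lambda>x. \<Sum>i\<in>I. \<phi> i x)"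
  by (induction I rule: infinite_finite_induct)
    (simp_all add: finite_horizon_const finite_horizon_combine[where F="(+)"])

lemma finite_horizon_Q:
  assumes "finite_horizon \<phi>"
  shows "finite_horizon (Q \<phi>)"
proof -
  obtain d where d: "\<And>k \<sigma> \<sigma>'. (\<forall>h. length h < d \<longrightarrow> \<sigma>' h = \<sigma> h) \<Longrightarrow> \<phi> (k, \<sigma>') = \<phi> (k, \<sigma>)"
    using assms(1) unfolding finite_horizon_def by blast
  show ?thesis
    unfolding finite_horizon_def
  proof (intro exI allI impI)
    fix k and \<sigma> \<sigma>' :: "('a, 's) strategy"
    assume *: "\<forall>h. length h < Suc d \<longrightarrow> \<sigma>' h = \<sigma> h"
    then have 0: "\<sigma>' [] = \<sigma> []" by simp
    have "\<phi> (k', after \<sigma>' s) = \<phi> (k', after \<sigma> s)" for k' s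
      using * by (intro d) (simp add: after_def residual_def)
    then show "Q \<phi> (k, \<sigma>') = Q \<phi> (k, \<sigma>)" by (simp add: Q_Pair 0)
  qed
qed

lemma finite_horizon_Qn: "finite_horizon \<phi> \<Longrightarrow> finite_horizon ((Q ^^ n) \<phi>)"
  by (induction n) (simp_all add: finite_horizon_Q)

lemma finite_horizon_avg: "finite_horizon (avg n)"
proof -
  have "finite_horizon rew"
    unfolding finite_horizon_def by (rule exI[of _ 1]) (simp add: rew_def)
  then have "finite_horizon (tot n)"
    unfolding tot_eq by (intro finite_horizon_sum finite_horizon_Qn)
  then show ?thesis
    unfolding avg_def[abs_def] by (rule finite_horizon_comp)
qed

text \<open>\<open>v\<close> is constant along transitions and under change of representative, so
  every block starting in a controlled state multiplies the Laplace transform by at most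
  \<open>exp (- (\<epsilon> * (v h k - 2 * \<epsilon>)))\<close>. One \<open>\<epsilon>\<close> is
  the gap between block average and \<open>v\<close>, the other the quadratic error.\<close>

lemma pay_restart:
  fixes R :: "('a \<times> 's) list \<Rightarrow> 'k set" and v :: "('a \<times> 's) list \<Rightarrow> 'k \<Rightarrow> real"
  assumes step: "\<And>h k h' k'. k \<in> R h \<Longrightarrow> reach k (residual \<sigma> h) h' k' \<Longrightarrow>
      k' \<in> R (h @ h') \<and> v (h @ h') k' = v h k"
    and key: "\<And>h h' k. key h = key h' \<Longrightarrow> k \<in> R h \<Longrightarrow> k \<in> R h' \<and> v h k = v h' k"
    and rep: "\<And>h. key (rep (key h)) = key h"
    and avg: "\<And>h k. k \<in> R (rep (key h)) \<Longrightarrow>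
      v (rep (key h)) k - \<epsilon> \<le> avg (Suc M) (k, residual \<sigma> (rep (key h)))"
    and \<epsilon>: "0 < \<epsilon>" "\<epsilon> \<le> 1"
    and k: "k \<in> R h"
  shows "v h k - 2 * \<epsilon> \<le> pay (k, restart \<sigma> rep key M (key h))"
proof -
  define N where "N = Suc M"
  \<comment> \<open>The error \<open>(t * N)\<^sup>2\<close> of \<open>mgf_le_quadratic\<close> over
    one block becomes \<open>\<epsilon>\<^sup>2\<close>.\<close>
  define t where "t = \<epsilon> / N"
  have t: "0 < t" "t * N = \<epsilon>" using \<epsilon> by (simp_all add: t_def N_def)
  let ?\<tau> = "restart \<sigma> rep key M"
  have blocks: "mgf t (j * N) (k, ?\<tau> (key h)) \<le> exp (- (j * \<epsilon> * (v h k - 2 * \<epsilon>)))"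
    if "k \<in> R h" for j k h
    using that
  proof (induction j arbitrary: k h)
    case 0
    show ?case by simp
  next
    case (Suc j)
    let ?w = "key h"
    let ?u = "v h k - 2 * \<epsilon>"
    \<comment> \<open>Play continues as if the past were \<open>rep ?w\<close>; equal keys keep
      \<open>k\<close> controlled with the same value.\<close>
    have k: "k \<in> R (rep ?w)" "v h k = v (rep ?w) k"
      using key[OF rep[of h, symmetric] Suc.prems] by simp_all
    have "mgf t (N + j * N) (k, ?\<tau> ?w) \<le> exp (- (j * \<epsilon> * ?u)) * mgf t N (k, residual \<sigma> (rep ?w))"
    proof (rule mgf_block)
      show "?\<tau> ?w h' = residual \<sigma> (rep ?w) h'" if "length h' < N" for h'
        using that by (subst restart.simps) (simp add: residual_def N_def)
    next
      fix h' k' assume h': "length h' = N" "reach k (residual \<sigma> (rep ?w)) h' k'"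
      have *: "k' \<in> R (rep ?w @ h')" "v (rep ?w @ h') k' = v h k"
        using step[OF k(1) h'(2)] k(2) by simp_all
      show "mgf t (j * N) (k', residual (?\<tau> ?w) h') \<le> exp (- (j * \<epsilon> * ?u))"
        using Suc.IH[OF *(1)] h'(1) by (simp add: residual_restart N_def *(2))
    qed
    also have "mgf t N (k, residual \<sigma> (rep ?w)) \<le> exp (- (\<epsilon> * ?u))"
    proof -
      have "tot N (k, residual \<sigma> (rep ?w)) = N * avg N (k, residual \<sigma> (rep ?w))"
        by (simp add: avg_def N_def)
      then have tot: "t * tot N (k, residual \<sigma> (rep ?w)) = \<epsilon> * avg N (k, residual \<sigma> (rep ?w))"
        by (simp add: t(2)[symmetric])
      have "mgf t N (k, residual \<sigma> (rep ?w)) \<le> 1 - t * tot N (k, residual \<sigma> (rep ?w)) + (t * N)\<^sup>2"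
        using t \<epsilon> by (intro mgf_le_quadratic) simp_all
      also have "\<dots> = 1 - \<epsilon> * (avg N (k, residual \<sigma> (rep ?w)) - \<epsilon>)"
        unfolding tot t(2) by (simp add: power2_eq_square algebra_simps)
      also have "\<dots> \<le> 1 - \<epsilon> * ?u"
        using avg[OF k(1)] k(2) \<epsilon> by (intro diff_left_mono mult_left_mono) (simp_all add: N_def)
      also have "\<dots> \<le> exp (- (\<epsilon> * ?u))"
        using exp_ge_add_one_self[of "- (\<epsilon> * ?u)"] by simp
      finally show ?thesis .
    qed
    finally have "mgf t (N + j * N) (k, ?\<tau> ?w) \<le> exp (- (j * \<epsilon> * ?u)) * exp (- (\<epsilon> * ?u))"
      by simp
    also have "\<dots> = exp (- (Suc j * \<epsilon> * ?u))"
      unfolding exp_add[symmetric] by (simp add: algebra_simps)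
    finally show ?case by simp
  qed
  define u where "u = v h k - 2 * \<epsilon>"
  show ?thesis
  \<comment> \<open>For nonnegative \<open>u\<close>, discarding an incomplete last block costs at
    most the constant factor \<open>exp (\<epsilon> * u)\<close>; otherwise
    \<open>pay_nonneg\<close> suffices.\<close>
  proof (cases "0 \<le> u")
    case True
    have "u \<le> pay (k, ?\<tau> (key h))"
    proof (rule pay_ge_of_mgf[OF t(1)])
      fix n :: nat
      have "n < n div N * N + N"
        using mod_less_divisor[of N n] div_mult_mod_eq[of n N] by (simp add: N_def del: mod_less_divisor)
      then have "real n \<le> real (n div N) * N + N"
        by (metis less_imp_le of_nat_add of_nat_le_iff of_nat_mult)
      then have "t * u * n \<le> t * u * (real (n div N) * N + N)"
        using t True by (intro mult_left_mono) simp_all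
      also have "\<dots> = real (n div N) * (t * N) * u + (t * N) * u" by (simp add: algebra_simps)
      finally have *: "- (real (n div N) * \<epsilon> * u) \<le> \<epsilon> * u - t * n * u"
        unfolding t(2) by (simp add: mult_ac)
      have "mgf t n (k, ?\<tau> (key h)) \<le> mgf t (n div N * N) (k, ?\<tau> (key h))"
        using t by (intro mgf_antimono) simp_all
      also have "\<dots> \<le> exp (- (real (n div N) * \<epsilon> * u))"
        unfolding u_def by (rule blocks[OF k])
      also have "\<dots> \<le> exp (\<epsilon> * u - t * n * u)" using * by simp
      finally show "mgf t n (k, ?\<tau> (key h)) \<le> exp (\<epsilon> * u - t * n * u)" .
    qed
    then show ?thesis by (simp add: u_def)
  next
    case False
    then show ?thesis
      using pay_nonneg[of "(k, ?\<tau> (key h))"] by (simp add: u_def)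
  qed
qed

end

section \<open>From near-constant averages to finite memory\<close>

context pomdp
begin

text \<open>The second summand is the conditional variance of \<open>avg (T i)\<close> after one transition.\<close>

definition osc :: "(nat \<Rightarrow> nat) \<Rightarrow> nat \<Rightarrow> 'k \<times> ('a, 's) strategy \<Rightarrow> real" where
  "osc T i x = (avg (T i) x - avg (T (Suc i)) x)\<^sup>2
     + (Q (\<lambda>y. (avg (T i) y)\<^sup>2) x - (Q (avg (T i)) x)\<^sup>2)"

text \<open>The factor is chosen so that \<open>penalty T c i x < 1\<close> forces \<open>osc T i \<le> (c / 2 ^ i)\<^sup>2\<close> at every state
  reachable from \<open>x\<close> in at most \<open>i\<close> steps.\<close>

definition penalty :: "(nat \<Rightarrow> nat) \<Rightarrow> real \<Rightarrow> nat \<Rightarrow> 'k \<times> ('a, 's) strategy \<Rightarrow> real" where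
  "penalty T c i x = (4 / qmin) ^ i / c\<^sup>2 * (\<Sum>j\<le>i. (Q ^^ j) (osc T i) x)"

lemma osc_nonneg: "0 \<le> osc T i x"
  using Q_power2[of "avg (T i)" x] by (simp add: osc_def)

lemma bdd_osc [simp]: "bdd (osc T i)"
  by (simp add: osc_def[abs_def])

lemma penalty_nonneg: "0 \<le> penalty T c i x"
  unfolding penalty_def using qmin(1)
  by (intro mult_nonneg_nonneg sum_nonneg Qn_ge osc_nonneg divide_nonneg_nonneg) simp_all

lemma bdd_penalty [simp]: "bdd (penalty T c i)"
  unfolding penalty_def[abs_def] by simp

lemma finite_horizon_penalty: "finite_horizon (penalty T c i)"
proof -
  have "finite_horizon (osc T i)"
    unfolding osc_def[abs_def]
    by (intro finite_horizon_combine[where F="(+)"] finite_horizon_combine[where F="(-)"]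
        finite_horizon_comp[where F="\<lambda>u. u\<^sup>2"] finite_horizon_Q finite_horizon_avg)
  then show ?thesis
    unfolding penalty_def[abs_def]
    by (intro finite_horizon_comp[where F="\<lambda>u. _ * u"] finite_horizon_sum finite_horizon_Qn)
qed

lemma osc_le_of_penalty:
  assumes c: "c > 0" and pen: "penalty T c i (k, \<sigma>) < 1" and r: "reach k \<sigma> h k'" and i: "length h \<le> i"
  shows "osc T i (k', residual \<sigma> h) \<le> (c * (1 / 2) ^ i)\<^sup>2"
proof -
  let ?o = "osc T i (k', residual \<sigma> h)"
  have "qmin ^ i * ?o \<le> qmin ^ length h * ?o"
    using qmin(1,2) i by (intro mult_right_mono osc_nonneg power_decreasing) simp_all
  also have "\<dots> \<le> (Q ^^ length h) (osc T i) (k, \<sigma>)"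
    by (rule reach_lower[OF osc_nonneg r])
  also have "\<dots> \<le> (\<Sum>j\<le>i. (Q ^^ j) (osc T i) (k, \<sigma>))"
    by (rule member_le_sum) (use i in \<open>auto intro!: Qn_ge osc_nonneg\<close>)
  finally have "(4 / qmin) ^ i / c\<^sup>2 * (qmin ^ i * ?o) \<le> penalty T c i (k, \<sigma>)"
    unfolding penalty_def using qmin(1) by (intro mult_left_mono) simp_all
  moreover have "(4 / qmin) ^ i / c\<^sup>2 * (qmin ^ i * ?o) = 4 ^ i / c\<^sup>2 * ?o"
    using qmin(1) by (simp add: power_divide)
  ultimately have "4 ^ i / c\<^sup>2 * ?o \<le> 1" using pen by linarith
  then have "?o \<le> c\<^sup>2 / 4 ^ i"
    using c by (simp add: field_simps)
  also have "\<dots> = (c * (1 / 2) ^ i)\<^sup>2"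
  proof -
    have *: "((1 / 2 :: real) ^ i)\<^sup>2 = (1 / 4) ^ i"
      by (simp add: power2_eq_square flip: power_mult_distrib)
    show ?thesis unfolding power_mult_distrib * by (simp add: power_divide)
  qed
  finally show ?thesis .
qed

lemma avg_diff_le_of_osc:
  assumes "osc T i x \<le> e\<^sup>2" "0 \<le> e"
  shows "\<bar>avg (T i) x - avg (T (Suc i)) x\<bar> \<le> e"
proof -
  have "(avg (T i) x - avg (T (Suc i)) x)\<^sup>2 \<le> e\<^sup>2"
    using assms(1) Q_power2[of "avg (T i)" x] by (simp add: osc_def)
  then show ?thesis using assms(2) by (simp add: abs_le_square_iff[symmetric])
qed

text \<open>The squared deviation of one successor enters the conditional variance with weight at
  least \<open>qmin\<close>, hence the factor \<open>1 / sqrt qmin\<close>; the term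
  \<open>1 / T i\<close> is the drift of the conditional mean.\<close>

lemma transition_diff_le_of_osc:
  assumes "osc T i (k, \<sigma>) \<le> e\<^sup>2" "0 \<le> e" and p: "0 < pmf (q k (\<sigma> [])) (k', s)" and T: "T i > 0"
  shows "\<bar>avg (T i) (k', after \<sigma> s) - avg (T i) (k, \<sigma>)\<bar> \<le> e / sqrt qmin + 1 / T i"
proof -
  let ?a = "avg (T i)"
  let ?m = "Q ?a (k, \<sigma>)"
  have "qmin * (?a (k', after \<sigma> s) - ?m)\<^sup>2 \<le> pmf (q k (\<sigma> [])) (k', s) * (?a (k', after \<sigma> s) - ?m)\<^sup>2"
    using qmin(3)[OF p] by (rule mult_right_mono) simp
  also have "\<dots> \<le> Q (\<lambda>y. (?a y - ?m)\<^sup>2) (k, \<sigma>)"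
    unfolding Q_Pair[of "\<lambda>y. (?a y - ?m)\<^sup>2"]
    using member_le_sum[of "(k', s)" UNIV "\<lambda>z. pmf (q k (\<sigma> [])) z * (?a (fst z, after \<sigma> (snd z)) - ?m)\<^sup>2"]
    by simp
  also have "\<dots> \<le> osc T i (k, \<sigma>)" by (simp add: Q_variance osc_def)
  also note assms(1)
  finally have "(?a (k', after \<sigma> s) - ?m)\<^sup>2 \<le> (e / sqrt qmin)\<^sup>2"
    using qmin(1) by (simp add: power_divide field_simps)
  then have "\<bar>?a (k', after \<sigma> s) - ?m\<bar> \<le> e / sqrt qmin"
    using assms(2) qmin(1) by (simp add: abs_le_square_iff[symmetric])
  moreover have "\<bar>?m - ?a (k, \<sigma>)\<bar> \<le> 1 / T i" by (rule abs_Q_avg_diff[OF T])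
  ultimately show ?thesis by linarith
qed

text \<open>The states that never incur penalty 1 have limiting averages that are constant along every
  transition; restarting whenever the vector of limits recurs keeps these limits with finitely many
  memory states.\<close>

lemma ex_finite_memory_local:
  assumes T: "\<And>i. T i > i" and e: "0 < e" "e \<le> 1"
  obtains \<tau> where "finite (range (residual \<tau>))"
    "\<And>k. (\<And>i. penalty T e i (k, \<sigma>) < 1) \<Longrightarrow> avg (T 0) (k, \<sigma>) - 4 * e \<le> pay (k, \<tau>)"
proof -
  define B where "B = {k. \<forall>i. penalty T e i (k, \<sigma>) < 1}"
  define R where "R = (\<lambda>h. {k'. \<exists>k\<in>B. reach k \<sigma> h k'})"
  define v where "v = (\<lambda>h k. lim (\<lambda>i. avg (T i) (k, residual \<sigma> h)))"
  have osc: "osc T i (k, residual \<sigma> h) \<le> (e * (1 / 2) ^ i)\<^sup>2" if "k \<in> R h" "length h \<le> i" for h k i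
  proof -
    from that(1) obtain k0 where "penalty T e i (k0, \<sigma>) < 1" "reach k0 \<sigma> h k"
      by (auto simp: R_def B_def)
    then show ?thesis using that(2) by (rule osc_le_of_penalty[OF e(1)])
  qed
  have diff: "\<bar>avg (T i) (k, residual \<sigma> h) - avg (T (Suc i)) (k, residual \<sigma> h)\<bar> \<le> e * (1 / 2) ^ i"
    if "k \<in> R h" "length h \<le> i" for h k i
    using that e by (intro avg_diff_le_of_osc osc) simp_all
  have lim: "(\<lambda>i. avg (T i) (k, residual \<sigma> h)) \<longlonglongrightarrow> v h k" if "k \<in> R h" for h k
    unfolding v_def convergent_LIMSEQ_iff[symmetric]
    by (rule geometric_Cauchy(1)[OF diff[OF that]]) (use e in auto)
  have v0: "\<bar>avg (T 0) (k, \<sigma>) - v [] k\<bar> \<le> 2 * e" if "k \<in> R []" for k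
    unfolding v_def residual_Nil
    by (rule geometric_Cauchy(2)[of 0]) (use e diff[OF that] in auto)
  have R_step: "k' \<in> R (h @ [(\<sigma> h, s)])" "v (h @ [(\<sigma> h, s)]) k' = v h k"
    if k: "k \<in> R h" and p: "0 < pmf (q k (\<sigma> h)) (k', s)" for h k k' s
  proof -
    have p': "0 < pmf (q k (residual \<sigma> h [])) (k', s)" using p by (simp add: residual_def)
    have aft: "after (residual \<sigma> h) s = residual \<sigma> (h @ [(\<sigma> h, s)])"
      by (simp add: after_def residual_at_Nil)
    from k obtain k0 where k0: "k0 \<in> B" "reach k0 \<sigma> h k" by (auto simp: R_def)
    have "reach k (residual \<sigma> h) [(\<sigma> h, s)] k'"
      using p by (simp add: residual_at_Nil)
    with k0 show k': "k' \<in> R (h @ [(\<sigma> h, s)])"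
      unfolding R_def by (blast intro: reach_append)
    \<comment> \<open>Both error terms of \<open>transition_diff_le_of_osc\<close> vanish, so the
      limits at the two ends of the transition are equal, not merely close.\<close>
    have "(\<lambda>i. avg (T i) (k', residual \<sigma> (h @ [(\<sigma> h, s)])) - avg (T i) (k, residual \<sigma> h)) \<longlonglongrightarrow> 0"
    proof (rule Lim_null_comparison)
      show "eventually (\<lambda>i. norm (avg (T i) (k', residual \<sigma> (h @ [(\<sigma> h, s)])) - avg (T i) (k, residual \<sigma> h))
          \<le> e * (1 / 2) ^ i / sqrt qmin + 1 / Suc i) sequentially"
      proof (rule eventually_sequentiallyI)
        fix i assume i: "length h \<le> i"
        have Ti: "Suc i \<le> T i" using T[of i] by simp
        have "\<bar>avg (T i) (k', after (residual \<sigma> h) s) - avg (T i) (k, residual \<sigma> h)\<bar>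
            \<le> e * (1 / 2) ^ i / sqrt qmin + 1 / T i"
          using osc[OF k i] e p' Ti by (intro transition_diff_le_of_osc) simp_all
        also have "1 / real (T i) \<le> 1 / Suc i"
          using Ti by (intro divide_left_mono) auto
        finally show "norm (avg (T i) (k', residual \<sigma> (h @ [(\<sigma> h, s)])) - avg (T i) (k, residual \<sigma> h))
            \<le> e * (1 / 2) ^ i / sqrt qmin + 1 / Suc i"
          unfolding aft real_norm_def by simp
      qed
      have "(\<lambda>i. e * (1 / 2) ^ i / sqrt qmin + 1 / Suc i) \<longlonglongrightarrow> e * 0 / sqrt qmin + 0"
        using qmin(1) by (intro tendsto_intros LIMSEQ_power_zero LIMSEQ_inverse_real_of_nat[unfolded inverse_eq_divide]) simp_all
      then show "(\<lambda>i. e * (1 / 2) ^ i / sqrt qmin + 1 / Suc i) \<longlonglongrightarrow> 0" by simp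
    qed
    moreover have "(\<lambda>i. avg (T i) (k', residual \<sigma> (h @ [(\<sigma> h, s)])) - avg (T i) (k, residual \<sigma> h))
        \<longlonglongrightarrow> v (h @ [(\<sigma> h, s)]) k' - v h k"
      by (intro tendsto_diff lim k k')
    ultimately show "v (h @ [(\<sigma> h, s)]) k' = v h k"
      using LIMSEQ_unique by fastforce
  qed
  have step: "k' \<in> R (h @ h') \<and> v (h @ h') k' = v h k"
    if "k \<in> R h" "reach k (residual \<sigma> h) h' k'" for h h' k k'
    using that
  proof (induction h' arbitrary: h k)
    case (Cons x h')
    obtain k1 where k1: "fst x = \<sigma> h" "0 < pmf (q k (\<sigma> h)) (k1, snd x)"
      "reach k1 (after (residual \<sigma> h) (snd x)) h' k'"
      using Cons.prems(2) by (auto simp: residual_at_Nil)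
    have x: "x = (\<sigma> h, snd x)" using k1(1) by (metis prod.collapse)
    have "reach k1 (residual \<sigma> (h @ [(\<sigma> h, snd x)])) h' k'"
      using k1(3) by (simp add: after_def residual_at_Nil)
    from Cons.IH[OF R_step(1)[OF Cons.prems(1) k1(2)] this] R_step(2)[OF Cons.prems(1) k1(2)]
    show ?case using x by (metis append.assoc append_Cons append_Nil)
  qed simp
  \<comment> \<open>Values outside \<open>R h\<close> are set to 0. Inside, each value is some
    \<open>v [] k0\<close>, because limits are constant along paths; so only finitely many keys
    occur.\<close>
  define key where "key = (\<lambda>h. (R h, \<lambda>k. if k \<in> R h then v h k else 0))"
  have key: "k \<in> R h' \<and> v h k = v h' k" if "key h = key h'" "k \<in> R h" for h h' k
    using that by (auto simp: key_def dest: fun_cong[where x=k])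
  have "key h \<in> UNIV \<times> PiE UNIV (\<lambda>_. insert 0 (v [] ` UNIV))" for h
  proof -
    have "v h k \<in> v [] ` UNIV" if "k \<in> R h" for k
    proof -
      from that obtain k0 where k0: "k0 \<in> B" "reach k0 \<sigma> h k" by (auto simp: R_def)
      then have "k0 \<in> R []" by (simp add: R_def)
      from step[OF this, of h k] k0 have "v h k = v [] k0" by simp
      then show ?thesis by blast
    qed
    then show ?thesis by (auto simp: key_def)
  qed
  then have "range key \<subseteq> UNIV \<times> PiE UNIV (\<lambda>_. insert 0 (v [] ` UNIV))" by blast
  moreover have "finite (UNIV \<times> PiE UNIV (\<lambda>_. insert 0 (v [] ` UNIV)) :: ('k set \<times> ('k \<Rightarrow> real)) set)"
    by (intro finite_cartesian_product finite_PiE) simp_all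
  ultimately have fin: "finite (range key)" by (rule finite_subset)
  define rep where "rep = inv key"
  have rep: "key (rep (key h)) = key h" for h
    by (simp add: rep_def f_inv_into_f)
  \<comment> \<open>Finitely many keys and states allow one index \<open>i\<close>, hence one block
    length \<open>T i\<close>, for all representatives.\<close>
  have "eventually (\<lambda>i. \<forall>w\<in>range key. \<forall>k\<in>R (rep w).
      v (rep w) k - e < avg (T i) (k, residual \<sigma> (rep w))) sequentially"
    using e by (intro eventually_ball_finite fin finite ballI order_tendstoD(1)[OF lim]) auto
  then obtain i where i: "\<And>w k. w \<in> range key \<Longrightarrow> k \<in> R (rep w) \<Longrightarrow>
      v (rep w) k - e < avg (T i) (k, residual \<sigma> (rep w))"
    unfolding eventually_sequentially by blast
  define M where "M = T i - 1"
  have M: "Suc M = T i" using T[of i] by (simp add: M_def)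
  show thesis
  proof (rule that)
    show "finite (range (residual (restart \<sigma> rep key M (key []))))"
      by (rule finite_residuals_restart[OF fin])
    fix k assume "\<And>i. penalty T e i (k, \<sigma>) < 1"
    then have k: "k \<in> R []" by (simp add: R_def B_def)
    have "v [] k - 2 * e \<le> pay (k, restart \<sigma> rep key M (key []))"
    proof (rule pay_restart[where R=R])
      show "v (rep (key h)) k - e \<le> avg (Suc M) (k, residual \<sigma> (rep (key h)))"
        if "k \<in> R (rep (key h))" for h k
        unfolding M using i[OF _ that] by (simp add: less_imp_le)
    qed (fact step key rep e k)+
    then show "avg (T 0) (k, \<sigma>) - 4 * e \<le> pay (k, restart \<sigma> rep key M (key []))"
      using v0[OF k] by linarith
  qed
qed

text \<open>Where some penalty reaches 1 the claim is trivial, since averages are at most 1 and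
  payoffs nonnegative; elsewhere the local construction applies. For a given strategy finitely many
  penalties cover all states of the first kind. The resulting bound has finite horizon, so the same
  \<open>\<tau>\<close> serves a whole cylinder, and compactness yields a common
  \<open>I\<close>.\<close>

lemma ex_finite_memory_uniform:
  assumes T: "\<And>i. T i > i" and e: "0 < e" "e \<le> 1"
  shows "\<exists>I. \<forall>\<sigma>. \<exists>\<tau>. finite (range (residual \<tau>)) \<and>
    (\<forall>k. avg (T 0) (k, \<sigma>) - (\<Sum>i\<le>I. penalty T e i (k, \<sigma>)) - 4 * e \<le> pay (k, \<tau>))"
proof (rule strategy_compactness)
  let ?P = "\<lambda>\<sigma> I \<tau>. finite (range (residual \<tau>)) \<and>
    (\<forall>k. avg (T 0) (k, \<sigma>) - (\<Sum>i\<le>I. penalty T e i (k, \<sigma>)) - 4 * e \<le> pay (k, \<tau>))"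
  show "\<exists>\<tau>. ?P \<sigma> J \<tau>" if P: "\<exists>\<tau>. ?P \<sigma> I \<tau>" and "I \<le> J" for \<sigma> I J
  proof -
    have "(\<Sum>i\<le>I. penalty T e i x) \<le> (\<Sum>i\<le>J. penalty T e i x)" for x
      using \<open>I \<le> J\<close> by (intro sum_mono2) (auto intro: penalty_nonneg)
    then have "avg (T 0) x - (\<Sum>i\<le>J. penalty T e i x) - 4 * e
        \<le> avg (T 0) x - (\<Sum>i\<le>I. penalty T e i x) - 4 * e" for x
      by (simp add: algebra_simps)
    then show ?thesis using P order_trans by blast
  qed
  fix \<sigma> :: "('a, 's) strategy"
  obtain \<tau> where \<tau>: "finite (range (residual \<tau>))"
    "\<And>k. (\<And>i. penalty T e i (k, \<sigma>) < 1) \<Longrightarrow> avg (T 0) (k, \<sigma>) - 4 * e \<le> pay (k, \<tau>)"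
    using ex_finite_memory_local[of T e \<sigma>] T e by blast
  \<comment> \<open>Where no penalty reaches 1 the index is arbitrary; it can only enlarge the
    maximum \<open>I\<close>.\<close>
  define idx where "idx = (\<lambda>k. SOME i. 1 \<le> penalty T e i (k, \<sigma>))"
  have idx: "1 \<le> penalty T e (idx k) (k, \<sigma>)" if "1 \<le> penalty T e j (k, \<sigma>)" for k j
    unfolding idx_def by (rule someI[of "\<lambda>i. 1 \<le> penalty T e i (k, \<sigma>)", OF that])
  define I where "I = Max (range idx)"
  have I: "idx k \<le> I" for k by (simp add: I_def)
  let ?\<phi> = "\<lambda>x. avg (T 0) x - (\<Sum>i\<le>I. penalty T e i x)"
  have \<phi>: "?\<phi> (k, \<sigma>) - 4 * e \<le> pay (k, \<tau>)" for k
  proof (cases "\<exists>j. 1 \<le> penalty T e j (k, \<sigma>)")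
    case True
    then have "1 \<le> penalty T e (idx k) (k, \<sigma>)" using idx by blast
    also have "\<dots> \<le> (\<Sum>i\<le>I. penalty T e i (k, \<sigma>))"
      by (rule member_le_sum) (use I in \<open>auto intro: penalty_nonneg\<close>)
    finally show ?thesis
      using avg_bounds(2)[of "T 0" "(k, \<sigma>)"] pay_nonneg[of "(k, \<tau>)"] e by linarith
  next
    case False
    then have "avg (T 0) (k, \<sigma>) - 4 * e \<le> pay (k, \<tau>)" by (intro \<tau>(2)) (simp add: not_le)
    moreover have "0 \<le> (\<Sum>i\<le>I. penalty T e i (k, \<sigma>))" by (intro sum_nonneg penalty_nonneg)
    ultimately show ?thesis by linarith
  qed
  have "finite_horizon ?\<phi>"
    by (intro finite_horizon_combine[where F="(-)"] finite_horizon_avg finite_horizon_sum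
        finite_horizon_penalty)
  then obtain d where d: "\<And>k \<sigma>'. (\<forall>h. length h < d \<longrightarrow> \<sigma>' h = \<sigma> h) \<Longrightarrow> ?\<phi> (k, \<sigma>') = ?\<phi> (k, \<sigma>)"
    unfolding finite_horizon_def by blast
  show "\<exists>d I. \<forall>\<sigma>'. (\<forall>h. length h < d \<longrightarrow> \<sigma>' h = \<sigma> h) \<longrightarrow> (\<exists>\<tau>. ?P \<sigma>' I \<tau>)"
  proof (intro exI allI impI conjI)
    fix \<sigma>' k assume "\<forall>h. length h < d \<longrightarrow> \<sigma>' h = \<sigma> h"
    from d[OF this] \<phi>[of k] show "?\<phi> (k, \<sigma>') - 4 * e \<le> pay (k, \<tau>)" by simp
  qed (rule \<tau>(1))
qed

end

text \<open>Under \<open>\<Lambda>\<close> each \<open>(Q ^^ j) (osc T i)\<close> counts as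
  \<open>osc T i\<close>, so the mean penalty is a constant independent of \<open>T\<close> times
  \<open>\<Lambda> (osc T i)\<close>, which is small once \<open>T i\<close> and
  \<open>T (Suc i)\<close> are large.\<close>

lemma (in invariant_mean) ex_small_penalties:
  assumes e: "e > 0"
  obtains T where "\<And>i. T i > i" "\<And>I. \<Lambda> (\<lambda>x. \<Sum>i\<le>I. penalty T e i x) \<le> e"
proof -
  define C where "C = (\<lambda>i::nat. (4 / qmin) ^ i / e\<^sup>2)"
  \<comment> \<open>Chosen so that \<open>C i * Suc i * \<eta> i\<close> equals
    \<open>e / 2 ^ Suc i\<close>; these numbers sum to at most \<open>e\<close>.\<close>
  define \<eta> where "\<eta> = (\<lambda>i::nat. e * (1 / 2) ^ Suc i / (C i * Suc i))"
  have C: "C i > 0" for i using qmin(1) e by (simp add: C_def)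
  then have \<eta>: "\<eta> i > 0" for i using e by (simp add: \<eta>_def)
  define large where "large = (\<lambda>i N. N > 0 \<and>
      (\<forall>n m. n \<ge> N \<longrightarrow> m \<ge> N \<longrightarrow> sqn (\<lambda>x. avg n x - avg m x) \<le> \<eta> i / 2) \<and>
      (\<forall>n\<ge>N. 2 / real n < \<eta> i / 2))"
  have "\<exists>N. large i N" for i
  proof -
    obtain N1 where N1: "N1 > 0" "\<And>n m. n \<ge> N1 \<Longrightarrow> m \<ge> N1 \<Longrightarrow> sqn (\<lambda>x. avg n x - avg m x) \<le> \<eta> i / 2"
      using sqn_avg_Cauchy[of "\<eta> i / 2"] \<eta>[of i] by auto
    obtain N2 :: nat where N2: "\<And>n. n \<ge> N2 \<Longrightarrow> 2 / real n < \<eta> i / 2"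
      using ex_nat_div_less[of "\<eta> i / 2" 2] \<eta>[of i] by auto
    have "large i (max N1 N2)"
      unfolding large_def using N1 N2 by auto
    then show ?thesis ..
  qed
  then have "large i (SOME N. large i N)" for i by (rule someI_ex)
  then obtain N where "\<And>i. large i (N i)" by (rule that)
  then have N: "\<And>i. N i > 0"
    "\<And>i n m. n \<ge> N i \<Longrightarrow> m \<ge> N i \<Longrightarrow> sqn (\<lambda>x. avg n x - avg m x) \<le> \<eta> i / 2"
    "\<And>i n. n \<ge> N i \<Longrightarrow> 2 / real n < \<eta> i / 2"
    unfolding large_def by blast+
  \<comment> \<open>Partial sums dominate \<open>N i\<close> at both \<open>i\<close> and
    \<open>Suc i\<close>, and exceed \<open>i\<close> because every \<open>N j\<close> is
    positive.\<close>
  define T where "T = (\<lambda>i. \<Sum>j\<le>i. N j)"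
  have T: "T i > i" for i
  proof (induction i)
    case (Suc i)
    then show ?case using N(1)[of "Suc i"] by (simp add: T_def)
  qed (use N(1) in \<open>simp add: T_def\<close>)
  have TN: "N i \<le> T i" "N i \<le> T (Suc i)" for i
    unfolding T_def by (rule member_le_sum; simp)+
  have mean_osc: "\<Lambda> (osc T i) \<le> \<eta> i" for i
  proof -
    have "\<Lambda> (osc T i) = sqn (\<lambda>x. avg (T i) x - avg (T (Suc i)) x) +
        \<Lambda> (\<lambda>x. Q (\<lambda>y. (avg (T i) y)\<^sup>2) x - (Q (avg (T i)) x)\<^sup>2)"
      unfolding osc_def[abs_def] by (rule mean_add) simp_all
    also have "\<dots> \<le> \<eta> i / 2 + 2 / T i"
      using T[of i] by (intro add_mono N(2) TN mean_variance_avg) simp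
    also have "\<dots> \<le> \<eta> i" using N(3)[OF TN(1), of i] by simp
    finally show ?thesis .
  qed
  have mean_penalty: "\<Lambda> (penalty T e i) \<le> e * (1 / 2) ^ Suc i" for i
  proof -
    have "penalty T e i = (\<lambda>x. C i * (\<Sum>j\<le>i. (Q ^^ j) (osc T i) x))"
      by (rule ext) (simp only: penalty_def C_def)
    then have "\<Lambda> (penalty T e i) = C i * (\<Sum>j\<le>i. \<Lambda> ((Q ^^ j) (osc T i)))"
      by (simp only:) (subst mean_cmult; simp add: mean_sum)
    also have "\<dots> = C i * (Suc i * \<Lambda> (osc T i))"
      by (simp add: mean_Qn)
    also have "\<dots> \<le> C i * (Suc i * \<eta> i)"
      using C[of i] by (intro mult_left_mono mean_osc) simp_all
    also have "\<dots> = e * (1 / 2) ^ Suc i"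
      using C[of i] by (simp add: \<eta>_def del: of_nat_Suc power_Suc)
    finally show ?thesis .
  qed
  have geo: "(\<Sum>i\<le>I. e * (1 / 2) ^ Suc i) = e - e * (1 / 2) ^ Suc I" for I
    by (induction I) simp_all
  show thesis
  proof (rule that)
    show "T i > i" for i by (rule T)
    fix I
    have "\<Lambda> (\<lambda>x. \<Sum>i\<le>I. penalty T e i x) = (\<Sum>i\<le>I. \<Lambda> (penalty T e i))"
      by (rule mean_sum) simp
    also have "\<dots> \<le> (\<Sum>i\<le>I. e * (1 / 2) ^ Suc i)" by (intro sum_mono mean_penalty)
    also have "\<dots> \<le> e" unfolding geo using e by simp
    finally show "\<Lambda> (\<lambda>x. \<Sum>i\<le>I. penalty T e i x) \<le> e" .
  qed
qed

section \<open>From a near-optimal strategy to finite memory\<close>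

lemma (in pomdp) payoff_inf_le_1: "payoff_inf q g p \<sigma> \<le> 1"
proof -
  have "payoff_inf q g p \<sigma> \<le> (\<Sum>k\<in>UNIV. pmf p k * 1)"
    unfolding payoff_inf_eq by (intro sum_mono mult_left_mono pay_le_1) simp
  then show ?thesis by simp
qed

text \<open>Of the loss \<open>6 * e\<close>, four parts come from
  \<open>ex_finite_memory_uniform\<close>, one from the mean penalties, and one makes the inequality
  strict so that a stage \<open>m\<close> can be extracted.\<close>

lemma (in pomdp) ex_finite_memory_near:
  assumes e: "0 < e" "e \<le> 1"
  obtains \<tau> where "finite_memory \<tau>" "payoff_inf q g p \<sigma> - 6 * e \<le> payoff_inf q g p \<tau>"
proof -
  obtain \<Lambda> where \<Lambda>: "invariant_mean q g \<Lambda>" "payoff_inf q g p \<sigma> \<le> \<Lambda> rew"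
    "\<And>\<phi> c. bdd \<phi> \<Longrightarrow> c < \<Lambda> \<phi> \<Longrightarrow> \<exists>m. c < (\<Sum>k\<in>UNIV. pmf p k * (Q ^^ m) \<phi> (k, \<sigma>))"
    using ex_invariant_mean[of p \<sigma>] by blast
  interpret invariant_mean q g \<Lambda> by (rule \<Lambda>(1))
  obtain T where T: "\<And>i. T i > i" "\<And>I. \<Lambda> (\<lambda>x. \<Sum>i\<le>I. penalty T e i x) \<le> e"
    using ex_small_penalties[OF e(1)] by blast
  obtain I where "\<forall>\<sigma>. \<exists>\<tau>. finite (range (residual \<tau>)) \<and>
      (\<forall>k. avg (T 0) (k, \<sigma>) - (\<Sum>i\<le>I. penalty T e i (k, \<sigma>)) - 4 * e \<le> pay (k, \<tau>))"
    using ex_finite_memory_uniform[of T e] T(1) e by blast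
  then obtain F where F: "\<And>\<sigma>. finite (range (residual (F \<sigma>)))"
    "\<And>\<sigma> k. avg (T 0) (k, \<sigma>) - (\<Sum>i\<le>I. penalty T e i (k, \<sigma>)) - 4 * e \<le> pay (k, F \<sigma>)"
    by metis
  define \<phi> where "\<phi> = (\<lambda>x. avg (T 0) x - (\<Sum>i\<le>I. penalty T e i x) - 4 * e)"
  have bdd_\<phi>: "bdd \<phi>" by (simp add: \<phi>_def)
  have "\<Lambda> \<phi> = \<Lambda> rew - \<Lambda> (\<lambda>x. \<Sum>i\<le>I. penalty T e i x) - 4 * e"
    using T(1)[of 0] by (simp add: \<phi>_def mean_diff mean_avg)
  then have "payoff_inf q g p \<sigma> - 6 * e < \<Lambda> \<phi>"
    using \<Lambda>(2) T(2)[of I] e by linarith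
  from \<Lambda>(3)[OF bdd_\<phi> this] obtain m where
    m: "payoff_inf q g p \<sigma> - 6 * e < (\<Sum>k\<in>UNIV. pmf p k * (Q ^^ m) \<phi> (k, \<sigma>))" by blast
  \<comment> \<open>The hidden state at the switch is unknown, so the replacement depends on the
    observed history alone; the bound for \<open>F\<close> holds for all hidden states at
    once.\<close>
  define \<tau> where "\<tau> = (\<lambda>h. if length h < m then \<sigma> h else F (residual \<sigma> (take m h)) (drop m h))"
  have res: "residual \<tau> h = F (residual \<sigma> h)" if "length h = m" for h
    using that by (auto simp: \<tau>_def residual_def)
  show thesis
  proof (rule that)
    show "finite_memory \<tau>"
    proof (rule finite_memory_if_finite_residuals, rule finite_residuals_if_later[of m])
      fix h :: "('a \<times> 's) list" assume "length h = m"
      then show "finite (range (residual (residual \<tau> h)))"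
        unfolding res[OF \<open>length h = m\<close>] by (intro F(1))
    qed
    have "(\<Sum>k\<in>UNIV. pmf p k * (Q ^^ m) \<phi> (k, \<sigma>)) \<le> (\<Sum>k\<in>UNIV. pmf p k * pay (k, \<tau>))"
    proof (intro sum_mono mult_left_mono pay_switch)
      show "\<tau> h = \<sigma> h" if "length h < m" for h using that by (simp add: \<tau>_def)
      show "\<phi> (k', residual \<sigma> h) \<le> pay (k', residual \<tau> h)" if "length h = m" for h k'
        using F(2) by (simp add: res[OF that] \<phi>_def)
    qed simp
    with m show "payoff_inf q g p \<sigma> - 6 * e \<le> payoff_inf q g p \<tau>"
      by (simp add: payoff_inf_eq)
  qed
qed

theorem theorem1:
  fixes q :: "'k::finite \<Rightarrow> 'a::finite \<Rightarrow> ('k \<times> 's::finite) pmf"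
    and g :: "'k \<Rightarrow> 'a \<Rightarrow> real"
    and p1 :: "'k pmf"
    and \<epsilon> :: real
  assumes "\<And>k a. 0 \<le> g k a \<and> g k a \<le> 1"
    and "\<epsilon> > 0"
  shows "\<exists>\<sigma> :: ('a, 's) strategy. finite_memory \<sigma> \<and>
           payoff_inf q g p1 \<sigma> \<ge> value_inf q g p1 - \<epsilon>"
proof -
  interpret pomdp q g by unfold_locales (use assms(1) in auto)
  \<comment> \<open>One \<open>e\<close> pays for near-optimality of \<open>\<sigma>\<close> and six
    for \<open>ex_finite_memory_near\<close>, which also asks for \<open>e \<le> 1\<close>.\<close>
  define e where "e = min 1 (\<epsilon> / 7)"
  have e: "0 < e" "e \<le> 1" "7 * e \<le> \<epsilon>" using assms(2) by (auto simp: e_def)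
  have "bdd_above (range (payoff_inf q g p1))"
    by (rule bdd_aboveI[of _ 1]) (auto intro: payoff_inf_le_1)
  then have "\<exists>\<sigma>\<in>UNIV. value_inf q g p1 - e < payoff_inf q g p1 \<sigma>"
    using e(1) by (subst less_cSUP_iff[symmetric]) (simp_all add: value_inf_def)
  then obtain \<sigma> where \<sigma>: "value_inf q g p1 - e < payoff_inf q g p1 \<sigma>" by blast
  obtain \<tau> where "finite_memory \<tau>" "payoff_inf q g p1 \<sigma> - 6 * e \<le> payoff_inf q g p1 \<tau>"
    using ex_finite_memory_near[OF e(1,2)] by blast
  then show ?thesis using \<sigma> e(3) by (intro exI[of _ \<tau>]) auto
qed

end
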